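(* Let $\mathcal{C}$ be an equational class of algebras. (i) If $\mathcal{C}$ is semi-degenerate and has equationally definable principal congruences (EDPC) and the compact intersection property (CIP), then any morphism in $\mathcal{C}$ is admissible and fulfills GU and LO. (ii) If $\mathcal{C}$ is semi-degenerate and has EDPC and the principal intersection property (PIP), then any morphism in $\mathcal{C}$ is admissible and fulfills GU and LO.
   Context: An equational class (variety) $\mathcal{C}$ of algebras of a fixed type is semi-degenerate if no non-trivial algebra in $\mathcal{C}$ has a one-element subalgebra. All algebras are non-empty; a morphism in $\mathcal{C}$ is a homomorphism between members of $\mathcal{C}$. For an algebra $M$, $\mathrm{Con}(M)$ is its congruence lattice, $\Delta_M$ is the equality relation, $\nabla_M=M^2$, and $Cg_M(a,b)$ (a principal congruence) is the congruence of $M$ generated by $(a,b)$; the compact congruences are the finitely generated ones. $\mathcal{C}$ has EDPC if there exist an integer $n\geq1$ and $4$-ary terms $p_1,q_1,\ldots,p_n,q_n$ in the language of $\mathcal{C}$ such that, for every algebra $M$ in $\mathcal{C}$ and all $a,b\in M$, $Cg_M(a,b)=\{(c,d)\in M^2 : p_i^M(a,b,c,d)=q_i^M(a,b,c,d)\text{ for all } i\in\{1,\ldots,n\}\}$. $\mathcal{C}$ has the CIP (respectively PIP) if, for any algebra $M$ in $\mathcal{C}$, the intersection of any two compact (respectively principal) congruences of $M$ is a compact (respectively principal) congruence of $M$. A class with EDPC is congruence-distributive (all its members have distributive congruence lattices), and hence the (modular) commutator of congruences in its members is the intersection; so a congruence $\phi\neq\nabla_M$ is prime if, for all $\alpha,\beta\in\mathrm{Con}(M)$,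 $\alpha\cap\beta\subseteq\phi$ implies $\alpha\subseteq\phi$ or $\beta\subseteq\phi$; $\mathrm{Spec}(M)$ is the set of prime congruences of $M$. For a morphism $f:A\to B$ and $\psi\in\mathrm{Con}(B)$, $f^*(\psi)=\{(x,y)\in A^2 : (f(x),f(y))\in\psi\}\in\mathrm{Con}(A)$ and $\mathrm{Ker}(f)=f^*(\Delta_B)$. $f$ is admissible if $f^*(\psi)\in\mathrm{Spec}(A)$ for all $\psi\in\mathrm{Spec}(B)$. An admissible morphism $f:A\to B$ fulfills GU (Going Up) if for all $\phi,\psi\in\mathrm{Spec}(A)$ and $\phi_1\in\mathrm{Spec}(B)$ with $\phi\subseteq\psi$ and $f^*(\phi_1)=\phi$ there is $\psi_1\in\mathrm{Spec}(B)$ with $\phi_1\subseteq\psi_1$ and $f^*(\psi_1)=\psi$; it fulfills LO (Lying Over) if for every $\phi\in\mathrm{Spec}(A)$ with $\mathrm{Ker}(f)\subseteq\phi$ there is $\phi_1\in\mathrm{Spec}(B)$ with $f^*(\phi_1)=\phi$. *)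

theory Defs
  imports Main
begin

section \<open>Algebras of a fixed finitary type\<close>

text \<open>The set of symbols is a set rather than a type, so that the empty signature is allowed.\<close>

record 'f signature =
  symbols :: "'f set"
  arity :: "'f \<Rightarrow> nat"

datatype (dead 'f, vars: 'v) trm = Var 'v | Fn 'f "('f, 'v) trm list"

fun wf_trm :: "'f signature \<Rightarrow> ('f, 'v) trm \<Rightarrow> bool" where
  "wf_trm S (Var v) \<longleftrightarrow> True"
| "wf_trm S (Fn g ts) \<longleftrightarrow>
     g \<in> symbols S \<and> length ts = arity S g \<and> (\<forall>t\<in>set ts. wf_trm S t)"

record ('f, 'a) algebra =
  carrier :: "'a set"
  interp :: "'f \<Rightarrow> 'a list \<Rightarrow> 'a"

definition closed_under_ops :: "'f signature \<Rightarrow> ('f, 'a) algebra \<Rightarrow> 'a set \<Rightarrow> bool" where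
  "closed_under_ops S M X \<longleftrightarrow>
     (\<forall>g\<in>symbols S. \<forall>xs. length xs = arity S g \<and> set xs \<subseteq> X \<longrightarrow> interp M g xs \<in> X)"

definition is_algebra :: "'f signature \<Rightarrow> ('f, 'a) algebra \<Rightarrow> bool" where
  "is_algebra S M \<longleftrightarrow> carrier M \<noteq> {} \<and> closed_under_ops S M (carrier M)"

text \<open>\<open>subuniverse S M X\<close>: \<open>X\<close> is the carrier of a (non-empty) subalgebra of \<open>M\<close>.\<close>

definition subuniverse :: "'f signature \<Rightarrow> ('f, 'a) algebra \<Rightarrow> 'a set \<Rightarrow> bool" where
  "subuniverse S M X \<longleftrightarrow> X \<noteq> {} \<and> X \<subseteq> carrier M \<and> closed_under_ops S M X"

fun eval :: "('f, 'a) algebra \<Rightarrow> ('v \<Rightarrow> 'a) \<Rightarrow> ('f, 'v) trm \<Rightarrow> 'a" where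
  "eval M \<rho> (Var v) = \<rho> v"
| "eval M \<rho> (Fn g ts) = interp M g (map (eval M \<rho>) ts)"

definition identities :: "'f signature \<Rightarrow> (('f, nat) trm \<times> ('f, nat) trm) set \<Rightarrow> bool" where
  "identities S E \<longleftrightarrow> (\<forall>(s, t)\<in>E. wf_trm S s \<and> wf_trm S t)"

text \<open>The members, among the algebras over the element type \<open>'a\<close>, of the equational class
  axiomatised by \<open>E\<close>.\<close>

definition models ::
  "'f signature \<Rightarrow> (('f, nat) trm \<times> ('f, nat) trm) set \<Rightarrow> ('f, 'a) algebra set" where
  "models S E = {M. is_algebra S M \<and>
     (\<forall>(s, t)\<in>E. \<forall>\<rho>. range \<rho> \<subseteq> carrier M \<longrightarrow> eval M \<rho> s = eval M \<rho> t)}"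

definition hom :: "'f signature \<Rightarrow> ('f, 'a) algebra \<Rightarrow> ('f, 'b) algebra \<Rightarrow> ('a \<Rightarrow> 'b) set" where
  "hom S A B = {f. f ` carrier A \<subseteq> carrier B \<and>
     (\<forall>g\<in>symbols S. \<forall>xs. length xs = arity S g \<and> set xs \<subseteq> carrier A \<longrightarrow>
        f (interp A g xs) = interp B g (map f xs))}"


section \<open>Congruences\<close>

definition Con :: "'f signature \<Rightarrow> ('f, 'a) algebra \<Rightarrow> 'a rel set" where
  "Con S M = {\<theta>. equiv (carrier M) \<theta> \<and>
     (\<forall>g\<in>symbols S. \<forall>xs ys. length xs = arity S g \<and> list_all2 (\<lambda>x y. (x, y) \<in> \<theta>) xs ys \<longrightarrow>
        (interp M g xs, interp M g ys) \<in> \<theta>)}"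

definition Delta :: "('f, 'a) algebra \<Rightarrow> 'a rel" where
  "Delta M = Id_on (carrier M)"

definition Nabla :: "('f, 'a) algebra \<Rightarrow> 'a rel" where
  "Nabla M = carrier M \<times> carrier M"

definition Cg :: "'f signature \<Rightarrow> ('f, 'a) algebra \<Rightarrow> 'a rel \<Rightarrow> 'a rel" where
  "Cg S M R = \<Inter>{\<theta> \<in> Con S M. R \<subseteq> \<theta>}"

definition principal_congs :: "'f signature \<Rightarrow> ('f, 'a) algebra \<Rightarrow> 'a rel set" where
  "principal_congs S M = {Cg S M {(a, b)} | a b. a \<in> carrier M \<and> b \<in> carrier M}"

definition compact_congs :: "'f signature \<Rightarrow> ('f, 'a) algebra \<Rightarrow> 'a rel set" where
  "compact_congs S M = {Cg S M R | R. finite R \<and> R \<subseteq> carrier M \<times> carrier M}"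

text \<open>Prime congruences. In a congruence-distributive setting the commutator of two
  congruences is their intersection, which is why the intersection appears here.\<close>

definition Spec :: "'f signature \<Rightarrow> ('f, 'a) algebra \<Rightarrow> 'a rel set" where
  "Spec S M = {\<phi> \<in> Con S M. \<phi> \<noteq> Nabla M \<and>
     (\<forall>\<alpha>\<in>Con S M. \<forall>\<beta>\<in>Con S M. \<alpha> \<inter> \<beta> \<subseteq> \<phi> \<longrightarrow> \<alpha> \<subseteq> \<phi> \<or> \<beta> \<subseteq> \<phi>)}"


section \<open>Properties of classes of algebras\<close>

definition semi_degenerate :: "'f signature \<Rightarrow> ('f, 'a) algebra set \<Rightarrow> bool" where
  "semi_degenerate S C \<longleftrightarrow>
     (\<forall>M\<in>C. \<not> is_singleton (carrier M) \<longrightarrow> (\<nexists>X. subuniverse S M X \<and> is_singleton X))"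

text \<open>A 4-ary term is a term in the variables \<open>0, 1, 2, 3\<close>.\<close>

definition quaternary :: "'f signature \<Rightarrow> ('f, nat) trm \<Rightarrow> bool" where
  "quaternary S t \<longleftrightarrow> wf_trm S t \<and> vars t \<subseteq> {..<4}"

definition eval4 :: "('f, 'a) algebra \<Rightarrow> ('f, nat) trm \<Rightarrow> 'a \<Rightarrow> 'a \<Rightarrow> 'a \<Rightarrow> 'a \<Rightarrow> 'a" where
  "eval4 M t a b c d = eval M (\<lambda>i. [a, b, c, d] ! i) t"

definition EDPC :: "'f signature \<Rightarrow> ('f, 'a) algebra set \<Rightarrow> bool" where
  "EDPC S C \<longleftrightarrow>
     (\<exists>n\<ge>1. \<exists>p q :: nat \<Rightarrow> ('f, nat) trm.
        (\<forall>i\<in>{1..n}. quaternary S (p i) \<and> quaternary S (q i)) \<and>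
        (\<forall>M\<in>C. \<forall>a\<in>carrier M. \<forall>b\<in>carrier M.
           Cg S M {(a, b)} = {(c, d) \<in> carrier M \<times> carrier M.
             \<forall>i\<in>{1..n}. eval4 M (p i) a b c d = eval4 M (q i) a b c d}))"

definition CIP :: "'f signature \<Rightarrow> ('f, 'a) algebra set \<Rightarrow> bool" where
  "CIP S C \<longleftrightarrow>
     (\<forall>M\<in>C. \<forall>\<alpha>\<in>compact_congs S M. \<forall>\<beta>\<in>compact_congs S M. \<alpha> \<inter> \<beta> \<in> compact_congs S M)"

definition PIP :: "'f signature \<Rightarrow> ('f, 'a) algebra set \<Rightarrow> bool" where
  "PIP S C \<longleftrightarrow>
     (\<forall>M\<in>C. \<forall>\<alpha>\<in>principal_congs S M. \<forall>\<beta>\<in>principal_congs S M. \<alpha> \<inter> \<beta> \<in> principal_congs S M)"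


section \<open>Properties of morphisms\<close>

text \<open>\<open>pullback A f \<psi>\<close> is \<open>f\<^sup>*(\<psi>)\<close>.\<close>

definition pullback :: "('f, 'a) algebra \<Rightarrow> ('a \<Rightarrow> 'b) \<Rightarrow> 'b rel \<Rightarrow> 'a rel" where
  "pullback A f \<psi> = {(x, y) \<in> carrier A \<times> carrier A. (f x, f y) \<in> \<psi>}"

definition Ker :: "('f, 'a) algebra \<Rightarrow> ('f, 'b) algebra \<Rightarrow> ('a \<Rightarrow> 'b) \<Rightarrow> 'a rel" where
  "Ker A B f = pullback A f (Delta B)"

definition admissible ::
  "'f signature \<Rightarrow> ('f, 'a) algebra \<Rightarrow> ('f, 'b) algebra \<Rightarrow> ('a \<Rightarrow> 'b) \<Rightarrow> bool" where
  "admissible S A B f \<longleftrightarrow> (\<forall>\<psi>\<in>Spec S B. pullback A f \<psi> \<in> Spec S A)"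

definition going_up ::
  "'f signature \<Rightarrow> ('f, 'a) algebra \<Rightarrow> ('f, 'b) algebra \<Rightarrow> ('a \<Rightarrow> 'b) \<Rightarrow> bool" where
  "going_up S A B f \<longleftrightarrow>
     (\<forall>\<phi>\<in>Spec S A. \<forall>\<psi>\<in>Spec S A. \<forall>\<phi>\<^sub>1\<in>Spec S B. \<phi> \<subseteq> \<psi> \<and> pullback A f \<phi>\<^sub>1 = \<phi> \<longrightarrow>
        (\<exists>\<psi>\<^sub>1\<in>Spec S B. \<phi>\<^sub>1 \<subseteq> \<psi>\<^sub>1 \<and> pullback A f \<psi>\<^sub>1 = \<psi>))"

definition lying_over ::
  "'f signature \<Rightarrow> ('f, 'a) algebra \<Rightarrow> ('f, 'b) algebra \<Rightarrow> ('a \<Rightarrow> 'b) \<Rightarrow> bool" where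
  "lying_over S A B f \<longleftrightarrow>
     (\<forall>\<phi>\<in>Spec S A. Ker A B f \<subseteq> \<phi> \<longrightarrow> (\<exists>\<phi>\<^sub>1\<in>Spec S B. pullback A f \<phi>\<^sub>1 = \<phi>))"


section \<open>A universe for an equational class\<close>

text \<open>
  An equational class contains algebras over every type, but a formula cannot quantify over
  types. A hypothesis about all members of the class is therefore stated for the members
  whose elements come from one type. The type below contains copies of \<open>'a\<close>, of \<open>'b\<close>, and of all
  terms over \<open>'a + 'b + nat\<close>; so it has isomorphic copies of all algebras over \<open>'a\<close> or \<open>'b\<close>, of
  their quotients, and of the free algebras of the class on \<open>'a + 'b + nat\<close> generators.
  Nothing depends on the term structure of its elements.
\<close>

type_synonym ('f, 'a, 'b) univ = "('f, 'a + 'b + nat) trm"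

end

(*
  EDPC makes "(c, d) lies in the join of Cg(a, b) and \<theta>" equivalent to finitely many equations
  modulo \<theta>. This condition is compatible with intersections in \<theta>, so joins distribute over
  finite meets of congruences, and with homomorphisms, so a join of f(\<phi>) with \<omega> in Con(B) has
  trace \<phi> on A whenever \<phi> contains f*(\<omega>). A maximal congruence above that join with trace
  \<phi> is prime by distributivity; this yields LO (\<omega> equality) and GU (\<omega> prime). For
  admissibility, CIP or PIP in a free algebra expresses Cg(a, b) \<inter> Cg(c, d) by finitely many
  pairs of terms in a, b, c, d, uniformly in all algebras of the class, so homomorphisms preserve
  such intersections up to generation; semi-degeneracy keeps the pullback proper.
*)

theory Submission
  imports Defs
begin

section \<open>Congruences\<close>

text \<open>The hypotheses on the class speak of one element type, while \<open>A\<close> and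
  \<open>B\<close> live on types of their own. EDPC is therefore applied to quotients copied into
  \<open>univ\<close> and brought back as a statement about pairs of the original algebra modulo a
  congruence \<theta>; the later arguments use EDPC only in this relative form. The obstacle in
  admissibility is that \<open>f\<close> need not be onto: a pair (u, v) in an intersection of
  principal congruences of \<open>B\<close> may lie outside the range of \<open>f\<close>, where the
  hypothesis on \<open>A\<close> says nothing. Equations overcome this. Membership of (u, v) in Cg(f
  a, f b) is a set of equations among f a, f b, u, v, hence visible in a free algebra with
  generators for these elements, modulo the kernel of evaluation. There the intersection has
  finitely many generating pairs; the free generators standing for u and v are chosen to avoid their
  variables, so these pairs evaluate inside the range of \<open>f\<close>. CIP and PIP enter only
  through a common consequence: two principal congruences have a compact intersection.\<close>

lemma Con_subset: "\<theta> \<in> Con S M \<Longrightarrow> \<theta> \<subseteq> carrier M \<times> carrier M"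
  by (auto simp: Con_def equiv_def)

lemma Con_carrier:
  assumes "\<theta> \<in> Con S M" "(x, y) \<in> \<theta>"
  shows "x \<in> carrier M" "y \<in> carrier M"
  using Con_subset[OF assms(1)] assms(2) by auto

lemma Con_refl: "\<theta> \<in> Con S M \<Longrightarrow> x \<in> carrier M \<Longrightarrow> (x, x) \<in> \<theta>"
  by (auto simp: Con_def equiv_def refl_on_def)

lemma Con_sym: "\<theta> \<in> Con S M \<Longrightarrow> (x, y) \<in> \<theta> \<Longrightarrow> (y, x) \<in> \<theta>"
  by (auto simp: Con_def equiv_def sym_def)

lemma Con_trans: "\<theta> \<in> Con S M \<Longrightarrow> (x, y) \<in> \<theta> \<Longrightarrow> (y, z) \<in> \<theta> \<Longrightarrow> (x, z) \<in> \<theta>"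
  unfolding Con_def equiv_def trans_def by blast

lemma Con_interp:
  "\<theta> \<in> Con S M \<Longrightarrow> g \<in> symbols S \<Longrightarrow> length xs = arity S g \<Longrightarrow>
    list_all2 (\<lambda>x y. (x, y) \<in> \<theta>) xs ys \<Longrightarrow> (interp M g xs, interp M g ys) \<in> \<theta>"
  by (auto simp: Con_def)

lemma ConI:
  assumes "\<And>x y. (x, y) \<in> \<theta> \<Longrightarrow> x \<in> carrier M \<and> y \<in> carrier M"
    and "\<And>x. x \<in> carrier M \<Longrightarrow> (x, x) \<in> \<theta>"
    and "\<And>x y. (x, y) \<in> \<theta> \<Longrightarrow> (y, x) \<in> \<theta>"
    and "\<And>x y z. (x, y) \<in> \<theta> \<Longrightarrow> (y, z) \<in> \<theta> \<Longrightarrow> (x, z) \<in> \<theta>"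
    and "\<And>g xs ys. g \<in> symbols S \<Longrightarrow> length xs = arity S g \<Longrightarrow>
      list_all2 (\<lambda>x y. (x, y) \<in> \<theta>) xs ys \<Longrightarrow> (interp M g xs, interp M g ys) \<in> \<theta>"
  shows "\<theta> \<in> Con S M"
  unfolding Con_def equiv_def
proof (intro CollectI conjI ballI allI impI)
  show "\<theta> \<subseteq> carrier M \<times> carrier M" using assms(1) by auto
  show "refl_on (carrier M) \<theta>" using assms(2) by (auto simp: refl_on_def)
  show "sym \<theta>" using assms(3) by (rule symI)
  show "trans \<theta>" using assms(4) by (rule transI)
qed (use assms(5) in blast)

lemma list_all2_carrier:
  assumes "list_all2 (\<lambda>x y. (x, y) \<in> \<theta>) xs ys" "\<theta> \<subseteq> X \<times> Y"
  shows "set xs \<subseteq> X" "set ys \<subseteq> Y" "length ys = length xs"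
  using assms by (induction rule: list_all2_induct) auto

lemma is_algebra_interp:
  "is_algebra S M \<Longrightarrow> g \<in> symbols S \<Longrightarrow> length xs = arity S g \<Longrightarrow> set xs \<subseteq> carrier M \<Longrightarrow>
    interp M g xs \<in> carrier M"
  by (auto simp: is_algebra_def closed_under_ops_def)

lemma Nabla_in_Con:
  assumes "is_algebra S M"
  shows "Nabla M \<in> Con S M"
proof (rule ConI)
  fix g xs ys
  assume "g \<in> symbols S" "length xs = arity S g" "list_all2 (\<lambda>x y. (x, y) \<in> Nabla M) xs ys"
  then show "(interp M g xs, interp M g ys) \<in> Nabla M"
    using list_all2_carrier[of "Nabla M" xs ys "carrier M" "carrier M"]
      is_algebra_interp[OF assms] by (simp add: Nabla_def)
qed (auto simp: Nabla_def)

lemma Delta_in_Con: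
  assumes "is_algebra S M"
  shows "Delta M \<in> Con S M"
proof (rule ConI)
  fix g xs ys
  assume g: "g \<in> symbols S" "length xs = arity S g"
    and eq: "list_all2 (\<lambda>x y. (x, y) \<in> Delta M) xs ys"
  have "set xs \<subseteq> carrier M" "ys = xs"
    using eq by (induction rule: list_all2_induct) (auto simp: Delta_def)
  then show "(interp M g xs, interp M g ys) \<in> Delta M"
    using is_algebra_interp[OF assms g] by (auto simp: Delta_def)
qed (auto simp: Delta_def)

lemma Con_Inter:
  assumes "K \<subseteq> Con S M" "K \<noteq> {}"
  shows "\<Inter>K \<in> Con S M"
proof (rule ConI)
  show "\<And>x y. (x, y) \<in> \<Inter>K \<Longrightarrow> x \<in> carrier M \<and> y \<in> carrier M"
    using assms Con_carrier by (metis InterE ex_in_conv subset_eq)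
  show "\<And>x. x \<in> carrier M \<Longrightarrow> (x, x) \<in> \<Inter>K"
    using assms Con_refl[of _ S M] by blast
  show "\<And>x y. (x, y) \<in> \<Inter>K \<Longrightarrow> (y, x) \<in> \<Inter>K"
    using assms Con_sym[of _ S M] by blast
  show "\<And>x y z. (x, y) \<in> \<Inter>K \<Longrightarrow> (y, z) \<in> \<Inter>K \<Longrightarrow> (x, z) \<in> \<Inter>K"
    using assms Con_trans[of _ S M] by (meson InterE InterI subsetD)
  fix g xs ys
  assume g: "g \<in> symbols S" "length xs = arity S g"
    and eq: "list_all2 (\<lambda>x y. (x, y) \<in> \<Inter>K) xs ys"
  show "(interp M g xs, interp M g ys) \<in> \<Inter>K"
  proof
    fix \<theta> assume "\<theta> \<in> K"
    then show "(interp M g xs, interp M g ys) \<in> \<theta>"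
      using Con_interp[OF _ g, of \<theta> M ys] assms(1) list_all2_mono[OF eq, of "\<lambda>x y. (x, y) \<in> \<theta>"]
      by blast
  qed
qed

lemma Con_Int: "\<alpha> \<in> Con S M \<Longrightarrow> \<beta> \<in> Con S M \<Longrightarrow> \<alpha> \<inter> \<beta> \<in> Con S M"
  using Con_Inter[of "{\<alpha>, \<beta>}" S M] by simp

text \<open>Operations are finitary: the finitely many pairs of arguments already lie in one member
  of a directed family. This is what makes directed unions of congruences compatible with the
  operations.\<close>

lemma list_all2_directed:
  assumes "K \<noteq> {}" "\<And>\<alpha> \<beta>. \<alpha> \<in> K \<Longrightarrow> \<beta> \<in> K \<Longrightarrow> \<exists>\<gamma>\<in>K. \<alpha> \<union> \<beta> \<subseteq> \<gamma>"
    and "list_all2 (\<lambda>x y. (x, y) \<in> \<Union>K) xs ys"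
  shows "\<exists>\<gamma>\<in>K. list_all2 (\<lambda>x y. (x, y) \<in> \<gamma>) xs ys"
  using assms(3)
proof (induction rule: list_all2_induct)
  case Nil
  then show ?case using assms(1) by auto
next
  case (Cons x xs y ys)
  obtain \<beta> where "\<beta> \<in> K" "list_all2 (\<lambda>x y. (x, y) \<in> \<beta>) xs ys" using Cons by blast
  moreover obtain \<alpha> where "\<alpha> \<in> K" "(x, y) \<in> \<alpha>" using Cons by blast
  moreover from calculation obtain \<gamma> where \<gamma>: "\<gamma> \<in> K" "\<alpha> \<union> \<beta> \<subseteq> \<gamma>" using assms(2) by blast
  ultimately have "list_all2 (\<lambda>x y. (x, y) \<in> \<gamma>) (x # xs) (y # ys)"
    by (auto elim!: list_all2_mono)
  then show ?case using \<gamma>(1) by blast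
qed

lemma Con_directed_Union:
  assumes K: "K \<subseteq> Con S M" "K \<noteq> {}"
    and directed: "\<And>\<alpha> \<beta>. \<alpha> \<in> K \<Longrightarrow> \<beta> \<in> K \<Longrightarrow> \<exists>\<gamma>\<in>K. \<alpha> \<union> \<beta> \<subseteq> \<gamma>"
  shows "\<Union>K \<in> Con S M"
proof (rule ConI)
  show "\<And>x y. (x, y) \<in> \<Union>K \<Longrightarrow> x \<in> carrier M \<and> y \<in> carrier M"
    using K Con_carrier by (metis UnionE subset_eq)
  show "\<And>x. x \<in> carrier M \<Longrightarrow> (x, x) \<in> \<Union>K"
    using K Con_refl[of _ S M] by blast
  show "\<And>x y. (x, y) \<in> \<Union>K \<Longrightarrow> (y, x) \<in> \<Union>K"
    using K Con_sym[of _ S M] by blast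
next
  fix x y z
  assume "(x, y) \<in> \<Union>K" "(y, z) \<in> \<Union>K"
  then obtain \<alpha> \<beta> where "\<alpha> \<in> K" "\<beta> \<in> K" "(x, y) \<in> \<alpha>" "(y, z) \<in> \<beta>" by blast
  moreover from calculation obtain \<gamma> where "\<gamma> \<in> K" "\<alpha> \<union> \<beta> \<subseteq> \<gamma>" using directed by blast
  ultimately show "(x, z) \<in> \<Union>K" using K(1) Con_trans[of \<gamma> S M x y z] by blast
next
  fix g xs ys
  assume g: "g \<in> symbols S" "length xs = arity S g"
    and eq: "list_all2 (\<lambda>x y. (x, y) \<in> \<Union>K) xs ys"
  obtain \<gamma> where "\<gamma> \<in> K" "list_all2 (\<lambda>x y. (x, y) \<in> \<gamma>) xs ys"
    using list_all2_directed[OF K(2) directed eq] by blast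
  then show "(interp M g xs, interp M g ys) \<in> \<Union>K" using Con_interp[OF _ g] K(1) by blast
qed

section \<open>Generated congruences and their finitary character\<close>

lemma Cg_in_Con:
  assumes "is_algebra S M" "R \<subseteq> carrier M \<times> carrier M"
  shows "Cg S M R \<in> Con S M"
  unfolding Cg_def using Nabla_in_Con[OF assms(1)] assms(2)
  by (intro Con_Inter) (auto simp: Nabla_def)

lemma Cg_superset: "R \<subseteq> Cg S M R"
  by (auto simp: Cg_def)

lemma Cg_least: "\<theta> \<in> Con S M \<Longrightarrow> R \<subseteq> \<theta> \<Longrightarrow> Cg S M R \<subseteq> \<theta>"
  by (auto simp: Cg_def)

lemma Cg_mono: "R \<subseteq> R' \<Longrightarrow> Cg S M R \<subseteq> Cg S M R'"
  by (auto simp: Cg_def)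

lemma Cg_id: "\<theta> \<in> Con S M \<Longrightarrow> Cg S M \<theta> = \<theta>"
  using Cg_least[of \<theta> S M \<theta>] Cg_superset by blast

lemma Cg_absorb:
  assumes "is_algebra S M" "R \<union> X \<subseteq> carrier M \<times> carrier M"
  shows "Cg S M (R \<union> Cg S M X) = Cg S M (R \<union> X)"
proof
  have "Cg S M X \<subseteq> Cg S M (R \<union> X)" by (rule Cg_mono) simp
  then show "Cg S M (R \<union> Cg S M X) \<subseteq> Cg S M (R \<union> X)"
    using Cg_superset[of "R \<union> X" S M] by (intro Cg_least Cg_in_Con assms) auto
  show "Cg S M (R \<union> X) \<subseteq> Cg S M (R \<union> Cg S M X)"
    using Cg_superset[of X S M] by (intro Cg_mono) auto
qed

text \<open>The congruences generated by \<theta> together with a finite part of \<open>X\<close>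
  form a directed family, so their union is a congruence containing \<open>X\<close> and \<theta>.
  The base \<theta> stays whole because EDPC is used modulo \<theta>, where only the added pairs
  must be finite in number.\<close>

lemma Cg_finitary:
  assumes M: "is_algebra S M" and X: "X \<union> \<theta> \<subseteq> carrier M \<times> carrier M"
    and cd: "(c, d) \<in> Cg S M (X \<union> \<theta>)"
  shows "\<exists>R. finite R \<and> R \<subseteq> X \<and> (c, d) \<in> Cg S M (R \<union> \<theta>)"
proof -
  define K where "K = {Cg S M (R \<union> \<theta>) | R. finite R \<and> R \<subseteq> X}"
  have "\<Union>K \<in> Con S M"
  proof (rule Con_directed_Union)
    show "K \<subseteq> Con S M" unfolding K_def using X by (auto intro!: Cg_in_Con[OF M])
    show "K \<noteq> {}" unfolding K_def by blast
    fix \<alpha> \<beta> assume "\<alpha> \<in> K" "\<beta> \<in> K"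
    then obtain P Q where PQ: "finite P" "P \<subseteq> X" "finite Q" "Q \<subseteq> X"
      and eq: "\<alpha> = Cg S M (P \<union> \<theta>)" "\<beta> = Cg S M (Q \<union> \<theta>)"
      unfolding K_def by blast
    have "\<alpha> \<union> \<beta> \<subseteq> Cg S M ((P \<union> Q) \<union> \<theta>)" unfolding eq by (intro Un_least Cg_mono) auto
    moreover have "Cg S M ((P \<union> Q) \<union> \<theta>) \<in> K" unfolding K_def using PQ by blast
    ultimately show "\<exists>\<gamma>\<in>K. \<alpha> \<union> \<beta> \<subseteq> \<gamma>" by blast
  qed
  moreover have "X \<union> \<theta> \<subseteq> \<Union>K"
  proof
    fix e assume "e \<in> X \<union> \<theta>"
    then have "e \<in> Cg S M (({e} \<inter> X) \<union> \<theta>)" using Cg_superset[of "({e} \<inter> X) \<union> \<theta>" S M] by auto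
    moreover have "Cg S M (({e} \<inter> X) \<union> \<theta>) \<in> K" unfolding K_def by blast
    ultimately show "e \<in> \<Union>K" by blast
  qed
  ultimately have "(c, d) \<in> \<Union>K" using cd Cg_least by blast
  then show ?thesis unfolding K_def by blast
qed


section \<open>Homomorphisms and homomorphic images\<close>

lemma hom_carrier: "f \<in> hom S A B \<Longrightarrow> x \<in> carrier A \<Longrightarrow> f x \<in> carrier B"
  by (auto simp: hom_def)

lemma hom_interp:
  "f \<in> hom S A B \<Longrightarrow> g \<in> symbols S \<Longrightarrow> length xs = arity S g \<Longrightarrow> set xs \<subseteq> carrier A \<Longrightarrow>
    f (interp A g xs) = interp B g (map f xs)"
  by (auto simp: hom_def)

text \<open>The assignment is constrained only on variables that occur: \<open>eval4\<close> looks
  values up in a list of length 4, so its assignment is unspecified from index 4 on.\<close>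

lemma eval_in_carrier:
  assumes "is_algebra S M"
  shows "wf_trm S t \<Longrightarrow> \<rho> ` vars t \<subseteq> carrier M \<Longrightarrow> eval M \<rho> t \<in> carrier M"
proof (induction t)
  case (Fn g ts)
  then show ?case
    by (force intro!: is_algebra_interp[OF assms])
qed simp

lemma hom_eval:
  assumes "is_algebra S A" "f \<in> hom S A B"
  shows "wf_trm S t \<Longrightarrow> \<rho> ` vars t \<subseteq> carrier A \<Longrightarrow> f (eval A \<rho> t) = eval B (f \<circ> \<rho>) t"
proof (induction t)
  case (Fn g ts)
  have "set (map (eval A \<rho>) ts) \<subseteq> carrier A"
    using Fn.prems by (force intro!: eval_in_carrier[OF assms(1)])
  then have "f (eval A \<rho> (Fn g ts)) = interp B g (map f (map (eval A \<rho>) ts))"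
    using Fn.prems hom_interp[OF assms(2), of g "map (eval A \<rho>) ts"] by simp
  also have "map f (map (eval A \<rho>) ts) = map (eval B (f \<circ> \<rho>)) ts"
    unfolding map_map
  proof (rule map_cong[OF refl])
    fix t assume t: "t \<in> set ts"
    then have "wf_trm S t" "\<rho> ` vars t \<subseteq> carrier A" using Fn.prems by auto
    then show "(f \<circ> eval A \<rho>) t = eval B (f \<circ> \<rho>) t" using Fn.IH[OF t] by (simp add: comp_def)
  qed
  finally show ?case by (simp add: comp_def)
qed simp

lemma eval_cong: "(\<And>v. v \<in> vars t \<Longrightarrow> \<rho> v = \<sigma> v) \<Longrightarrow> eval M \<rho> t = eval M \<sigma> t"
proof (induction t)
  case (Fn g ts)
  then have "map (eval M \<rho>) ts = map (eval M \<sigma>) ts" by auto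
  then show ?case by (simp only: eval.simps)
qed simp

lemma finite_vars: "finite (vars t)"
  by (induction t) auto

lemma quaternary_vars: "v < 4 \<Longrightarrow> [a, b, c, d] ! v \<in> {a, b, c, d}" for v :: nat
  by (auto simp: less_Suc_eq numeral_eq_Suc)

lemma eval4_in_carrier:
  assumes "is_algebra S M" "quaternary S t" "{a, b, c, d} \<subseteq> carrier M"
  shows "eval4 M t a b c d \<in> carrier M"
  using assms quaternary_vars[of _ a b c d] unfolding eval4_def quaternary_def
  by (intro eval_in_carrier) fast+

lemma hom_eval4:
  assumes "is_algebra S A" "f \<in> hom S A B" "quaternary S t" "{a, b, c, d} \<subseteq> carrier A"
  shows "f (eval4 A t a b c d) = eval4 B t (f a) (f b) (f c) (f d)"
proof -
  have "f (eval4 A t a b c d) = eval B (f \<circ> (\<lambda>i. [a, b, c, d] ! i)) t"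
    using assms quaternary_vars[of _ a b c d] unfolding eval4_def quaternary_def
    by (intro hom_eval) fast+
  also have "\<dots> = eval4 B t (f a) (f b) (f c) (f d)"
    unfolding eval4_def
  proof (rule eval_cong)
    fix v assume "v \<in> vars t"
    then have "v < 4" using assms(3) by (auto simp: quaternary_def)
    then show "(f \<circ> (\<lambda>i. [a, b, c, d] ! i)) v = [f a, f b, f c, f d] ! v"
      by (auto simp: less_Suc_eq numeral_eq_Suc)
  qed
  finally show ?thesis .
qed

section \<open>Pullbacks of congruences\<close>

lemma pullback_in_Con:
  assumes A: "is_algebra S A" and f: "f \<in> hom S A B" and \<psi>: "\<psi> \<in> Con S B"
  shows "pullback A f \<psi> \<in> Con S A"
proof (rule ConI)
  show "\<And>x. x \<in> carrier A \<Longrightarrow> (x, x) \<in> pullback A f \<psi>"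
    using hom_carrier[OF f] Con_refl[OF \<psi>] by (auto simp: pullback_def)
  show "\<And>x y. (x, y) \<in> pullback A f \<psi> \<Longrightarrow> (y, x) \<in> pullback A f \<psi>"
    using Con_sym[OF \<psi>] by (auto simp: pullback_def)
  show "\<And>x y z. (x, y) \<in> pullback A f \<psi> \<Longrightarrow> (y, z) \<in> pullback A f \<psi> \<Longrightarrow> (x, z) \<in> pullback A f \<psi>"
    using Con_trans[OF \<psi>] by (auto simp: pullback_def)
next
  fix g xs ys
  assume g: "g \<in> symbols S" "length xs = arity S g"
    and eq: "list_all2 (\<lambda>x y. (x, y) \<in> pullback A f \<psi>) xs ys"
  have "pullback A f \<psi> \<subseteq> carrier A \<times> carrier A" by (auto simp: pullback_def)
  note c = list_all2_carrier[OF eq this]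
  have "list_all2 (\<lambda>x y. (x, y) \<in> \<psi>) (map f xs) (map f ys)"
    using eq by (auto simp: list.rel_map pullback_def elim!: list_all2_mono)
  then show "(interp A g xs, interp A g ys) \<in> pullback A f \<psi>"
    using c g is_algebra_interp[OF A g(1)] Con_interp[OF \<psi> g(1)]
    by (simp add: pullback_def hom_interp[OF f])
qed (auto simp: pullback_def)

lemma pullback_subset_carrier: "pullback A f \<psi> \<subseteq> carrier A \<times> carrier A"
  by (auto simp: pullback_def)

text \<open>It suffices to check generators, since the pullback of the target congruence is itself a
  congruence.\<close>

lemma hom_Cg:
  assumes A: "is_algebra S A" and B: "is_algebra S B" and f: "f \<in> hom S A B"
    and R: "R \<subseteq> carrier A \<times> carrier A" and Q: "Q \<subseteq> carrier B \<times> carrier B"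
    and RQ: "\<And>x y. (x, y) \<in> R \<Longrightarrow> (f x, f y) \<in> Cg S B Q"
    and xy: "(x, y) \<in> Cg S A R"
  shows "(f x, f y) \<in> Cg S B Q"
proof -
  have "Cg S A R \<subseteq> pullback A f (Cg S B Q)"
    using R RQ by (intro Cg_least pullback_in_Con[OF A f] Cg_in_Con[OF B Q])
      (auto simp: pullback_def)
  then show ?thesis using xy by (auto simp: pullback_def)
qed

text \<open>The quotient of \<open>M\<close> by the kernel of \<open>\<pi>\<close>, realised on the range of \<open>\<pi>\<close>. Taking for \<open>\<pi>\<close> a
  choice of representatives keeps the quotient on the element type of \<open>M\<close>.\<close>

definition image_algebra :: "('a \<Rightarrow> 'b) \<Rightarrow> ('f, 'a) algebra \<Rightarrow> ('f, 'b) algebra" where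
  "image_algebra \<pi> M = \<lparr>carrier = \<pi> ` carrier M,
     interp = (\<lambda>g ys. \<pi> (interp M g (map (inv_into (carrier M) \<pi>) ys)))\<rparr>"

text \<open>Unlike \<open>Ker\<close>, this does not mention a target algebra, so it can be assumed
  to be a congruence before the image algebra is known to receive a homomorphism.\<close>

definition ker_rel :: "('a \<Rightarrow> 'b) \<Rightarrow> ('f, 'a) algebra \<Rightarrow> 'a rel" where
  "ker_rel \<pi> M = {(x, y) \<in> carrier M \<times> carrier M. \<pi> x = \<pi> y}"

lemma carrier_image_algebra: "carrier (image_algebra \<pi> M) = \<pi> ` carrier M"
  by (simp add: image_algebra_def)

text \<open>Operations of the image are computed on chosen preimages; compatibility of the kernel
  makes the choice immaterial.\<close>

lemma hom_image_algebra:
  assumes "ker_rel \<pi> M \<in> Con S M"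
  shows "\<pi> \<in> hom S M (image_algebra \<pi> M)"
  unfolding hom_def
proof (intro CollectI conjI ballI allI impI)
  fix g xs assume g: "g \<in> symbols S" and xs: "length xs = arity S g \<and> set xs \<subseteq> carrier M"
  have "list_all2 (\<lambda>x y. (x, y) \<in> ker_rel \<pi> M) xs (map (inv_into (carrier M) \<pi> \<circ> \<pi>) xs)"
    using xs by (auto simp: list.rel_map ker_rel_def inv_into_into f_inv_into_f
        intro!: list.rel_refl_strong)
  then show "\<pi> (interp M g xs) = interp (image_algebra \<pi> M) g (map \<pi> xs)"
    using Con_interp[OF assms g] xs by (auto simp: image_algebra_def ker_rel_def)
qed (simp add: carrier_image_algebra)

lemma ex_preimage_list:
  assumes "set ys \<subseteq> \<pi> ` X"
  shows "\<exists>xs. set xs \<subseteq> X \<and> ys = map \<pi> xs"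
proof -
  have "ys \<in> lists (\<pi> ` X)" using assms by (simp add: lists_eq_set)
  then show ?thesis unfolding lists_image by (auto simp: lists_eq_set)
qed

lemma is_algebra_onto:
  assumes M: "is_algebra S M" and \<pi>: "\<pi> \<in> hom S M N" and onto: "carrier N = \<pi> ` carrier M"
  shows "is_algebra S N"
  unfolding is_algebra_def closed_under_ops_def
proof (intro conjI ballI allI impI)
  show "carrier N \<noteq> {}" using M by (simp add: onto is_algebra_def)
  fix g ys assume g: "g \<in> symbols S" and ys: "length ys = arity S g \<and> set ys \<subseteq> carrier N"
  obtain xs where "set xs \<subseteq> carrier M" "ys = map \<pi> xs"
    using ex_preimage_list ys onto by metis
  then show "interp N g ys \<in> carrier N"
    using hom_interp[OF \<pi> g, of xs] is_algebra_interp[OF M g, of xs] ys onto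
    by (metis imageI length_map)
qed

lemma ex_lift_assignment:
  assumes "range \<rho> \<subseteq> \<pi> ` X"
  shows "\<exists>\<sigma>. range \<sigma> \<subseteq> X \<and> \<rho> = \<pi> \<circ> \<sigma>"
proof -
  have "\<forall>v. \<exists>x. x \<in> X \<and> \<rho> v = \<pi> x" using assms by blast
  then obtain \<sigma> where "\<forall>v. \<sigma> v \<in> X \<and> \<rho> v = \<pi> (\<sigma> v)" by metis
  then show ?thesis by (intro exI[of _ \<sigma>]) auto
qed

text \<open>The identities need hold in \<open>M\<close> only after applying \<pi>. This serves
  quotients of members of the class and also the term algebra, which in general violates the
  identities before it is factored.\<close>

lemma models_onto:
  assumes M: "is_algebra S M" and \<pi>: "\<pi> \<in> hom S M N" and onto: "carrier N = \<pi> ` carrier M"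
    and E: "identities S E"
    and sat: "\<And>s t \<sigma>. (s, t) \<in> E \<Longrightarrow> range \<sigma> \<subseteq> carrier M \<Longrightarrow> \<pi> (eval M \<sigma> s) = \<pi> (eval M \<sigma> t)"
  shows "N \<in> models S E"
proof -
  have "eval N \<rho> s = eval N \<rho> t" if st: "(s, t) \<in> E" and \<rho>: "range \<rho> \<subseteq> carrier N" for s t \<rho>
  proof -
    obtain \<sigma> where \<sigma>: "range \<sigma> \<subseteq> carrier M" "\<rho> = \<pi> \<circ> \<sigma>"
      using ex_lift_assignment \<rho> onto by metis
    have "\<sigma> ` V \<subseteq> carrier M" for V using \<sigma>(1) by blast
    moreover have "wf_trm S s" "wf_trm S t" using E st by (auto simp: identities_def)
    ultimately show ?thesis
      using sat[OF st \<sigma>(1)] hom_eval[OF M \<pi>] \<sigma>(2) by metis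
  qed
  then show ?thesis using is_algebra_onto[OF M \<pi> onto] by (auto simp: models_def)
qed

lemma modelsD:
  assumes "M \<in> models S E"
  shows "is_algebra S M"
    and "(s, t) \<in> E \<Longrightarrow> range \<rho> \<subseteq> carrier M \<Longrightarrow> eval M \<rho> s = eval M \<rho> t"
  using assms by (auto simp: models_def)

text \<open>This is the correspondence between congruences of an image and congruences above the
  kernel. Since \<Gamma> contains the kernel, its image is a congruence, and it bounds the one
  generated by the image of \<open>R\<close>.\<close>

lemma Cg_onto:
  assumes M: "is_algebra S M" and \<pi>: "\<pi> \<in> hom S M N" and onto: "carrier N = \<pi> ` carrier M"
    and ker: "ker_rel \<pi> M \<in> Con S M" and R: "R \<subseteq> carrier M \<times> carrier M"
    and c: "c \<in> carrier M" and d: "d \<in> carrier M"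
  shows "(\<pi> c, \<pi> d) \<in> Cg S N (map_prod \<pi> \<pi> ` R) \<longleftrightarrow> (c, d) \<in> Cg S M (R \<union> ker_rel \<pi> M)"
proof
  have N: "is_algebra S N" by (rule is_algebra_onto[OF M \<pi> onto])
  let ?\<Gamma> = "Cg S M (R \<union> ker_rel \<pi> M)"
  have k: "ker_rel \<pi> M \<subseteq> carrier M \<times> carrier M" by (auto simp: ker_rel_def)
  have Q: "map_prod \<pi> \<pi> ` R \<subseteq> carrier N \<times> carrier N" using R onto by auto
  {
    assume "(c, d) \<in> ?\<Gamma>"
    then show "(\<pi> c, \<pi> d) \<in> Cg S N (map_prod \<pi> \<pi> ` R)"
    proof (rule hom_Cg[OF M N \<pi> _ Q, rotated 2])
      fix x y assume "(x, y) \<in> R \<union> ker_rel \<pi> M"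
      then show "(\<pi> x, \<pi> y) \<in> Cg S N (map_prod \<pi> \<pi> ` R)"
      proof
        assume "(x, y) \<in> R"
        then show ?thesis using Cg_superset[of "map_prod \<pi> \<pi> ` R" S N] by force
      next
        assume "(x, y) \<in> ker_rel \<pi> M"
        then show ?thesis using Con_refl[OF Cg_in_Con[OF N Q]] onto by (auto simp: ker_rel_def)
      qed
    qed (use R k in auto)
  }
  have \<Gamma>: "?\<Gamma> \<in> Con S M" using R k by (intro Cg_in_Con M) auto
  have sup: "R \<subseteq> ?\<Gamma>" "ker_rel \<pi> M \<subseteq> ?\<Gamma>" using Cg_superset[of "R \<union> ker_rel \<pi> M" S M] by auto
  \<comment> \<open>Saturation: membership in \<Gamma> does not depend on which preimages are
    taken.\<close>
  have \<Gamma>': "(x, y) \<in> ?\<Gamma>" if "x \<in> carrier M" "y \<in> carrier M" and xy': "(\<pi> x, \<pi> y) \<in> map_prod \<pi> \<pi> ` ?\<Gamma>" for x y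
  proof -
    obtain x' y' where xy: "(x', y') \<in> ?\<Gamma>" "\<pi> x = \<pi> x'" "\<pi> y = \<pi> y'"
      using xy' by auto
    then have "(x, x') \<in> ?\<Gamma>" "(y', y) \<in> ?\<Gamma>"
      using that sup(2) Con_carrier[OF \<Gamma> xy(1)] by (auto simp: ker_rel_def)
    then show ?thesis using xy(1) Con_trans[OF \<Gamma>] by blast
  qed
  have "map_prod \<pi> \<pi> ` ?\<Gamma> \<in> Con S N"
  proof (rule ConI)
    fix x y assume "(x, y) \<in> map_prod \<pi> \<pi> ` ?\<Gamma>"
    then show "x \<in> carrier N \<and> y \<in> carrier N" using Con_carrier[OF \<Gamma>] onto by auto
  next
    fix x assume "x \<in> carrier N"
    then show "(x, x) \<in> map_prod \<pi> \<pi> ` ?\<Gamma>" using Con_refl[OF \<Gamma>] onto by force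
  next
    fix x y assume "(x, y) \<in> map_prod \<pi> \<pi> ` ?\<Gamma>"
    then show "(y, x) \<in> map_prod \<pi> \<pi> ` ?\<Gamma>" using Con_sym[OF \<Gamma>] by force
  next
    fix x y z assume "(x, y) \<in> map_prod \<pi> \<pi> ` ?\<Gamma>" and yz: "(y, z) \<in> map_prod \<pi> \<pi> ` ?\<Gamma>"
    then obtain x' y' where xy: "(x', y') \<in> ?\<Gamma>" "x = \<pi> x'" "y = \<pi> y'" by auto
    obtain y2 z' where "(y2, z') \<in> ?\<Gamma>" "z = \<pi> z'" using yz by auto
    then have z: "z' \<in> carrier M" "z = \<pi> z'" using Con_carrier[OF \<Gamma>] by auto
    \<comment> \<open>\<open>y'\<close> and \<open>y2\<close> may be different preimages of
      \<open>y\<close>; saturation makes the two pairs composable.\<close>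
    have "(y', z') \<in> ?\<Gamma>" using yz xy z Con_carrier[OF \<Gamma> xy(1)] by (intro \<Gamma>') auto
    then have "(x', z') \<in> ?\<Gamma>" using xy(1) Con_trans[OF \<Gamma>] by blast
    then show "(x, z) \<in> map_prod \<pi> \<pi> ` ?\<Gamma>" using xy z by force
  next
    fix g xs ys
    assume g: "g \<in> symbols S" "length xs = arity S g"
      and eq: "list_all2 (\<lambda>x y. (x, y) \<in> map_prod \<pi> \<pi> ` ?\<Gamma>) xs ys"
    have "map_prod \<pi> \<pi> ` ?\<Gamma> \<subseteq> carrier N \<times> carrier N" using Con_subset[OF \<Gamma>] onto by auto
    note cN = list_all2_carrier[OF eq this]
    obtain xs' where xs': "set xs' \<subseteq> carrier M" "xs = map \<pi> xs'"
      using ex_preimage_list cN(1) onto by metis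
    obtain ys' where ys': "set ys' \<subseteq> carrier M" "ys = map \<pi> ys'"
      using ex_preimage_list cN(2) onto by metis
    have "list_all2 (\<lambda>x y. (\<pi> x, \<pi> y) \<in> map_prod \<pi> \<pi> ` ?\<Gamma>) xs' ys'"
      using eq unfolding xs'(2) ys'(2) list.rel_map .
    then have "list_all2 (\<lambda>x y. (x, y) \<in> ?\<Gamma>) xs' ys'"
      by (rule list.rel_mono_strong) (rule \<Gamma>'[OF subsetD[OF xs'(1)] subsetD[OF ys'(1)]])
    then have "(interp M g xs', interp M g ys') \<in> ?\<Gamma>"
      using Con_interp[OF \<Gamma> g(1), of xs' ys'] g(2) xs'(2) by simp
    then have "(\<pi> (interp M g xs'), \<pi> (interp M g ys')) \<in> map_prod \<pi> \<pi> ` ?\<Gamma>" by force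
    then show "(interp N g xs, interp N g ys) \<in> map_prod \<pi> \<pi> ` ?\<Gamma>"
      using hom_interp[OF \<pi> g(1), of xs'] hom_interp[OF \<pi> g(1), of ys'] g(2) cN(3) xs' ys' by simp
  qed
  moreover have "map_prod \<pi> \<pi> ` R \<subseteq> map_prod \<pi> \<pi> ` ?\<Gamma>" using sup(1) by auto
  ultimately have "Cg S N (map_prod \<pi> \<pi> ` R) \<subseteq> map_prod \<pi> \<pi> ` ?\<Gamma>" by (rule Cg_least)
  then show "(c, d) \<in> ?\<Gamma>" if "(\<pi> c, \<pi> d) \<in> Cg S N (map_prod \<pi> \<pi> ` R)" using \<Gamma>'[OF c d] that by blast
qed

section \<open>Quotients on chosen representatives\<close>

definition rep :: "'a rel \<Rightarrow> 'a \<Rightarrow> 'a" where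
  "rep \<theta> x = (SOME y. (x, y) \<in> \<theta>)"

lemma rep_in:
  assumes "\<theta> \<in> Con S M" "x \<in> carrier M"
  shows "(x, rep \<theta> x) \<in> \<theta>"
  unfolding rep_def by (rule someI[of _ x]) (rule Con_refl[OF assms])

lemma rep_eq_iff:
  assumes \<theta>: "\<theta> \<in> Con S M" and "x \<in> carrier M" "y \<in> carrier M"
  shows "rep \<theta> x = rep \<theta> y \<longleftrightarrow> (x, y) \<in> \<theta>"
proof
  assume "rep \<theta> x = rep \<theta> y"
  then show "(x, y) \<in> \<theta>"
    using rep_in[OF assms(1,2)] rep_in[OF assms(1,3)] Con_sym[OF \<theta>] Con_trans[OF \<theta>] by metis
next
  assume "(x, y) \<in> \<theta>"
  then have "(x, z) \<in> \<theta> \<longleftrightarrow> (y, z) \<in> \<theta>" for z using Con_sym[OF \<theta>] Con_trans[OF \<theta>] by metis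
  then show "rep \<theta> x = rep \<theta> y" by (simp add: rep_def)
qed

lemma ker_rel_rep:
  assumes \<theta>: "\<theta> \<in> Con S M" and j: "inj j"
  shows "ker_rel (j \<circ> rep \<theta>) M = \<theta>"
  using Con_carrier[OF \<theta>] rep_eq_iff[OF \<theta>] j by (auto simp: ker_rel_def inj_eq)

text \<open>The injection \<open>j\<close> carries the representatives to another element type, so a
  quotient of an algebra over any type that embeds in the universe becomes a member to which the
  class hypotheses apply.\<close>

lemma quotient_in_models:
  assumes E: "identities S E" and M: "M \<in> models S E" and \<theta>: "\<theta> \<in> Con S M" and j: "inj j"
  shows "image_algebra (j \<circ> rep \<theta>) M \<in> models S E"
proof (rule models_onto[OF modelsD(1)[OF M] _ carrier_image_algebra E])
  show "j \<circ> rep \<theta> \<in> hom S M (image_algebra (j \<circ> rep \<theta>) M)"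
    by (rule hom_image_algebra) (simp only: ker_rel_rep[OF \<theta> j] \<theta>)
qed (simp add: modelsD(2)[OF M])


section \<open>Algebras with equationally definable principal congruences\<close>

text \<open>The defining equations are read modulo an arbitrary congruence \<open>\<theta>\<close>, which amounts to EDPC
  for all quotients of \<open>M\<close>.\<close>

locale edpc_algebra =
  fixes S :: "'f signature" and n :: nat and p q :: "nat \<Rightarrow> ('f, nat) trm"
    and M :: "('f, 'a) algebra"
  assumes algebra: "is_algebra S M"
    and quaternary: "\<And>i. i \<in> {1..n} \<Longrightarrow> quaternary S (p i) \<and> quaternary S (q i)"
    and Cg_insert_iff: "\<And>\<theta> a b c d. \<theta> \<in> Con S M \<Longrightarrow> {a, b, c, d} \<subseteq> carrier M \<Longrightarrow>
      (c, d) \<in> Cg S M (insert (a, b) \<theta>) \<longleftrightarrow>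
      (\<forall>i\<in>{1..n}. (eval4 M (p i) a b c d, eval4 M (q i) a b c d) \<in> \<theta>)"
begin

lemma eval4_carrier:
  "i \<in> {1..n} \<Longrightarrow> {a, b, c, d} \<subseteq> carrier M \<Longrightarrow>
    eval4 M (p i) a b c d \<in> carrier M \<and> eval4 M (q i) a b c d \<in> carrier M"
  using eval4_in_carrier[OF algebra, of _ a b c d] quaternary[of i] by simp

lemma Cg_insert_Cg:
  assumes "insert e R \<union> \<alpha> \<subseteq> carrier M \<times> carrier M"
  shows "Cg S M (insert e (Cg S M (R \<union> \<alpha>))) = Cg S M (insert e R \<union> \<alpha>)"
  using Cg_absorb[OF algebra, of "{e}" "R \<union> \<alpha>"] assms by simp

text \<open>Equations hold modulo an intersection exactly when they hold modulo both congruences,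
  and membership in each of the three joins is such a system with the same terms.\<close>

lemma Cg_insert_Int:
  assumes \<alpha>: "\<alpha> \<in> Con S M" and \<beta>: "\<beta> \<in> Con S M" and ab: "a \<in> carrier M" "b \<in> carrier M"
  shows "Cg S M (insert (a, b) \<alpha>) \<inter> Cg S M (insert (a, b) \<beta>) \<subseteq> Cg S M (insert (a, b) (\<alpha> \<inter> \<beta>))"
proof (rule subrelI)
  fix c d assume cd: "(c, d) \<in> Cg S M (insert (a, b) \<alpha>) \<inter> Cg S M (insert (a, b) \<beta>)"
  have "Cg S M (insert (a, b) \<alpha>) \<subseteq> carrier M \<times> carrier M"
    using ab Con_subset[OF \<alpha>] by (intro Con_subset[OF Cg_in_Con[OF algebra]]) auto
  then have "{a, b, c, d} \<subseteq> carrier M" using cd ab by auto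
  note iff = Cg_insert_iff[OF _ this]
  show "(c, d) \<in> Cg S M (insert (a, b) (\<alpha> \<inter> \<beta>))"
    using cd iff[OF \<alpha>] iff[OF \<beta>] iff[OF Con_Int[OF \<alpha> \<beta>]] by blast
qed

text \<open>Pairs are added one at a time: by \<open>Cg_insert_Cg\<close> the join already formed
  with \<open>R\<close> serves as the congruence modulo which the next pair is treated.\<close>

lemma Cg_finite_Int:
  assumes \<alpha>: "\<alpha> \<in> Con S M" and \<beta>: "\<beta> \<in> Con S M"
    and "finite R" "R \<subseteq> carrier M \<times> carrier M"
  shows "Cg S M (R \<union> \<alpha>) \<inter> Cg S M (R \<union> \<beta>) \<subseteq> Cg S M (R \<union> (\<alpha> \<inter> \<beta>))"
  using assms(3,4)
proof (induction R rule: finite_induct)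
  case empty
  then show ?case by (simp add: Cg_id Con_Int \<alpha> \<beta>)
next
  case (insert e R)
  obtain a b where e: "e = (a, b)" by fastforce
  note sub = Con_subset[OF \<alpha>] Con_subset[OF \<beta>]
  have in_Con: "Cg S M (R \<union> \<alpha>) \<in> Con S M" "Cg S M (R \<union> \<beta>) \<in> Con S M"
    using insert.prems sub by (auto intro!: Cg_in_Con[OF algebra])
  have "Cg S M (insert e R \<union> \<alpha>) \<inter> Cg S M (insert e R \<union> \<beta>)
      = Cg S M (insert e (Cg S M (R \<union> \<alpha>))) \<inter> Cg S M (insert e (Cg S M (R \<union> \<beta>)))"
    using insert.prems sub by (subst (1 2) Cg_insert_Cg) auto
  also have "\<dots> \<subseteq> Cg S M (insert e (Cg S M (R \<union> \<alpha>) \<inter> Cg S M (R \<union> \<beta>)))"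
    unfolding e using insert.prems e by (intro Cg_insert_Int in_Con) auto
  also have "\<dots> \<subseteq> Cg S M (insert e (Cg S M (R \<union> (\<alpha> \<inter> \<beta>))))"
    using insert.IH insert.prems by (intro Cg_mono) auto
  also have "\<dots> = Cg S M (insert e R \<union> (\<alpha> \<inter> \<beta>))"
    using insert.prems sub by (intro Cg_insert_Cg) auto
  finally show ?case .
qed

lemma Cg_Int_distrib:
  assumes \<alpha>: "\<alpha> \<in> Con S M" and \<beta>: "\<beta> \<in> Con S M" and X: "X \<subseteq> carrier M \<times> carrier M"
  shows "Cg S M (X \<union> \<alpha>) \<inter> Cg S M (X \<union> \<beta>) \<subseteq> Cg S M (X \<union> (\<alpha> \<inter> \<beta>))"
proof (rule subrelI)
  fix c d assume cd: "(c, d) \<in> Cg S M (X \<union> \<alpha>) \<inter> Cg S M (X \<union> \<beta>)"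
  have "X \<union> \<alpha> \<subseteq> carrier M \<times> carrier M" "X \<union> \<beta> \<subseteq> carrier M \<times> carrier M"
    using X Con_subset[OF \<alpha>] Con_subset[OF \<beta>] by auto
  then obtain P Q where P: "finite P" "P \<subseteq> X" "(c, d) \<in> Cg S M (P \<union> \<alpha>)"
    and Q: "finite Q" "Q \<subseteq> X" "(c, d) \<in> Cg S M (Q \<union> \<beta>)"
    using Cg_finitary[OF algebra] cd by (metis IntD1 IntD2)
  \<comment> \<open>The two memberships need different finite parts of \<open>X\<close>; their union
    serves both.\<close>
  have "Cg S M (P \<union> \<alpha>) \<subseteq> Cg S M ((P \<union> Q) \<union> \<alpha>)" "Cg S M (Q \<union> \<beta>) \<subseteq> Cg S M ((P \<union> Q) \<union> \<beta>)"
    by (intro Cg_mono; blast)+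
  then have "(c, d) \<in> Cg S M ((P \<union> Q) \<union> (\<alpha> \<inter> \<beta>))"
    using P Q X Cg_finite_Int[OF \<alpha> \<beta>, of "P \<union> Q"] by blast
  also have "\<dots> \<subseteq> Cg S M (X \<union> (\<alpha> \<inter> \<beta>))" using P Q by (intro Cg_mono) auto
  finally show "(c, d) \<in> Cg S M (X \<union> (\<alpha> \<inter> \<beta>))" .
qed

end

text \<open>EDPC is applied to the quotient by \<theta>, copied into \<open>'b\<close> along
  \<open>j\<close>. By correspondence its principal congruences are the joins of principal
  congruences of \<open>M\<close> with \<theta>, and equality in it is membership in
  \<theta>.\<close>

lemma edpc_algebra_models:
  fixes M :: "('f, 'a) algebra" and j :: "'a \<Rightarrow> 'b" and p q :: "nat \<Rightarrow> ('f, nat) trm"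
  assumes E: "identities S E" and M: "M \<in> models S E" and j: "inj j"
    and pq: "\<And>i. i \<in> {1..n} \<Longrightarrow> quaternary S (p i) \<and> quaternary S (q i)"
    and EDPC: "\<And>(N :: ('f, 'b) algebra) a b. N \<in> models S E \<Longrightarrow> a \<in> carrier N \<Longrightarrow> b \<in> carrier N \<Longrightarrow>
      Cg S N {(a, b)} = {(c, d) \<in> carrier N \<times> carrier N.
        \<forall>i\<in>{1..n}. eval4 N (p i) a b c d = eval4 N (q i) a b c d}"
  shows "edpc_algebra S n p q M"
proof
  show alg: "is_algebra S M" by (rule modelsD(1)[OF M])
  show "quaternary S (p i) \<and> quaternary S (q i)" if "i \<in> {1..n}" for i by (rule pq[OF that])
  fix \<theta> a b c d assume \<theta>: "\<theta> \<in> Con S M" and abcd: "{a, b, c, d} \<subseteq> carrier M"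
  define \<pi> where "\<pi> = j \<circ> rep \<theta>"
  define N where "N = image_algebra \<pi> M"
  have ker: "ker_rel \<pi> M = \<theta>" unfolding \<pi>_def by (rule ker_rel_rep[OF \<theta> j])
  have \<pi>: "\<pi> \<in> hom S M N" unfolding N_def by (rule hom_image_algebra) (simp only: ker \<theta>)
  have onto: "carrier N = \<pi> ` carrier M" unfolding N_def by (rule carrier_image_algebra)
  have N: "N \<in> models S E" unfolding N_def \<pi>_def by (rule quotient_in_models[OF E M \<theta> j])
  have "(c, d) \<in> Cg S M (insert (a, b) \<theta>) \<longleftrightarrow> (\<pi> c, \<pi> d) \<in> Cg S N {(\<pi> a, \<pi> b)}"
    using Cg_onto[OF alg \<pi> onto _ _ , of "{(a, b)}" c d] \<theta> abcd ker by simp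
  also have "\<dots> \<longleftrightarrow> (\<forall>i\<in>{1..n}. eval4 N (p i) (\<pi> a) (\<pi> b) (\<pi> c) (\<pi> d)
      = eval4 N (q i) (\<pi> a) (\<pi> b) (\<pi> c) (\<pi> d))"
    using abcd onto by (subst EDPC[OF N]) auto
  also have "\<dots> \<longleftrightarrow> (\<forall>i\<in>{1..n}. \<pi> (eval4 M (p i) a b c d) = \<pi> (eval4 M (q i) a b c d))"
    using hom_eval4[OF alg \<pi> _ abcd] pq by simp
  also have "\<dots> \<longleftrightarrow> (\<forall>i\<in>{1..n}. (eval4 M (p i) a b c d, eval4 M (q i) a b c d) \<in> \<theta>)"
    using eval4_in_carrier[OF alg _ abcd] pq unfolding ker[symmetric] by (simp add: ker_rel_def)
  finally show "(c, d) \<in> Cg S M (insert (a, b) \<theta>) \<longleftrightarrow>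
    (\<forall>i\<in>{1..n}. (eval4 M (p i) a b c d, eval4 M (q i) a b c d) \<in> \<theta>)" .
qed


section \<open>Extending prime congruences along a homomorphism\<close>

text \<open>The equations defining \<open>Cg(f a, f b)\<close> on elements \<open>f u, f v\<close> are images of equations in \<open>A\<close>,
  so generating in \<open>B\<close> adds nothing to the trace on \<open>A\<close>.\<close>

lemma pullback_Cg_finite:
  assumes A: "edpc_algebra S n p q A" and B: "edpc_algebra S n p q B" and f: "f \<in> hom S A B"
    and \<omega>: "\<omega> \<in> Con S B"
    and "finite R" "R \<subseteq> carrier A \<times> carrier A"
    and "u \<in> carrier A" "v \<in> carrier A" "(f u, f v) \<in> Cg S B (map_prod f f ` R \<union> \<omega>)"
  shows "(u, v) \<in> Cg S A (R \<union> pullback A f \<omega>)"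
  using assms(5-)
\<comment> \<open>The pair must vary: the induction hypothesis is applied to the values of
  \<open>p i\<close> and \<open>q i\<close>, not to (u, v).\<close>
proof (induction R arbitrary: u v rule: finite_induct)
  case empty
  then have "(u, v) \<in> pullback A f \<omega>" by (simp add: Cg_id[OF \<omega>] pullback_def)
  then show ?case using Cg_superset by auto
next
  case (insert e R)
  interpret A: edpc_algebra S n p q A by (rule A)
  interpret B: edpc_algebra S n p q B by (rule B)
  obtain a b where e: "e = (a, b)" by fastforce
  have abuv: "{a, b, u, v} \<subseteq> carrier A" using insert.prems e by auto
  have fabuv: "{f a, f b, f u, f v} \<subseteq> carrier B" using abuv hom_carrier[OF f] by auto
  have R': "map_prod f f ` R \<union> \<omega> \<subseteq> carrier B \<times> carrier B"
    using insert.prems hom_carrier[OF f] Con_subset[OF \<omega>] by auto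
  have R: "R \<union> pullback A f \<omega> \<subseteq> carrier A \<times> carrier A"
    using insert.prems pullback_subset_carrier by auto
  let ?\<beta> = "Cg S B (map_prod f f ` R \<union> \<omega>)" and ?\<alpha> = "Cg S A (R \<union> pullback A f \<omega>)"
  have "(f u, f v) \<in> Cg S B (insert (f a, f b) ?\<beta>)"
    using insert.prems(4) R' fabuv by (subst B.Cg_insert_Cg) (auto simp: e)
  then have "\<forall>i\<in>{1..n}. (eval4 B (p i) (f a) (f b) (f u) (f v), eval4 B (q i) (f a) (f b) (f u) (f v)) \<in> ?\<beta>"
    by (rule B.Cg_insert_iff[THEN iffD1, OF Cg_in_Con[OF B.algebra R'] fabuv])
  \<comment> \<open>All four arguments come from \<open>A\<close>, so both sides are again images
    under \<open>f\<close> and the induction hypothesis applies to them.\<close>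
  then have "\<forall>i\<in>{1..n}. (f (eval4 A (p i) a b u v), f (eval4 A (q i) a b u v)) \<in> ?\<beta>"
    using hom_eval4[OF A.algebra f _ abuv] A.quaternary by simp
  then have "\<forall>i\<in>{1..n}. (eval4 A (p i) a b u v, eval4 A (q i) a b u v) \<in> ?\<alpha>"
    using insert.IH insert.prems(1) A.eval4_carrier[OF _ abuv] by simp
  then have "(u, v) \<in> Cg S A (insert (a, b) ?\<alpha>)"
    by (rule A.Cg_insert_iff[THEN iffD2, OF Cg_in_Con[OF A.algebra R] abuv])
  then show ?case using R abuv A.Cg_insert_Cg[of e R "pullback A f \<omega>"] by (simp add: e)
qed

text \<open>Only finitely many pairs of \<phi> are responsible for a given pair in the join, which
  reduces the claim to the finite case.\<close>

lemma pullback_Cg_subset: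
  assumes A: "edpc_algebra S n p q A" and B: "edpc_algebra S n p q B" and f: "f \<in> hom S A B"
    and \<omega>: "\<omega> \<in> Con S B" and \<phi>: "\<phi> \<in> Con S A" and sub: "pullback A f \<omega> \<subseteq> \<phi>"
  shows "pullback A f (Cg S B (map_prod f f ` \<phi> \<union> \<omega>)) \<subseteq> \<phi>"
proof (rule subrelI)
  fix u v assume uv: "(u, v) \<in> pullback A f (Cg S B (map_prod f f ` \<phi> \<union> \<omega>))"
  have "map_prod f f ` \<phi> \<union> \<omega> \<subseteq> carrier B \<times> carrier B"
    using Con_subset[OF \<phi>] Con_subset[OF \<omega>] hom_carrier[OF f] by auto
  moreover have "(f u, f v) \<in> Cg S B (map_prod f f ` \<phi> \<union> \<omega>)"
    using uv by (simp add: pullback_def)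
  ultimately obtain R'
    where "finite R'" "R' \<subseteq> map_prod f f ` \<phi>" "(f u, f v) \<in> Cg S B (R' \<union> \<omega>)"
    using Cg_finitary[OF edpc_algebra.algebra[OF B]] by metis
  then obtain R where R: "finite R" "R \<subseteq> \<phi>" "(f u, f v) \<in> Cg S B (map_prod f f ` R \<union> \<omega>)"
    by (metis finite_subset_image)
  have "(u, v) \<in> Cg S A (R \<union> pullback A f \<omega>)"
    using R uv Con_subset[OF \<phi>]
    by (intro pullback_Cg_finite[OF A B f \<omega>]) (auto simp: pullback_def)
  then show "(u, v) \<in> \<phi>" using Cg_least[OF \<phi>, of "R \<union> pullback A f \<omega>"] R(2) sub by blast
qed

lemma prime_extension:
  assumes A: "edpc_algebra S n p q A" and B: "edpc_algebra S n p q B" and f: "f \<in> hom S A B"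
    and \<omega>: "\<omega> \<in> Con S B" and \<phi>: "\<phi> \<in> Spec S A" and sub: "pullback A f \<omega> \<subseteq> \<phi>"
  shows "\<exists>\<phi>\<^sub>1\<in>Spec S B. \<omega> \<subseteq> \<phi>\<^sub>1 \<and> pullback A f \<phi>\<^sub>1 = \<phi>"
proof -
  interpret A: edpc_algebra S n p q A by (rule A)
  interpret B: edpc_algebra S n p q B by (rule B)
  have \<phi>_Con: "\<phi> \<in> Con S A" and \<phi>_proper: "\<phi> \<noteq> Nabla A"
    and \<phi>_prime: "\<And>\<alpha> \<beta>. \<alpha> \<in> Con S A \<Longrightarrow> \<beta> \<in> Con S A \<Longrightarrow> \<alpha> \<inter> \<beta> \<subseteq> \<phi> \<Longrightarrow> \<alpha> \<subseteq> \<phi> \<or> \<beta> \<subseteq> \<phi>"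
    using \<phi> by (auto simp: Spec_def)
  define \<chi> where "\<chi> = Cg S B (map_prod f f ` \<phi> \<union> \<omega>)"
  have "map_prod f f ` \<phi> \<union> \<omega> \<subseteq> carrier B \<times> carrier B"
    using Con_subset[OF \<phi>_Con] Con_subset[OF \<omega>] hom_carrier[OF f] by auto
  then have \<chi>: "\<chi> \<in> Con S B" unfolding \<chi>_def by (rule Cg_in_Con[OF B.algebra])
  have \<chi>_sup: "map_prod f f ` \<phi> \<subseteq> \<chi>" "\<omega> \<subseteq> \<chi>"
    using Cg_superset[of "map_prod f f ` \<phi> \<union> \<omega>" S B] by (auto simp: \<chi>_def)
  \<comment> \<open>Only inclusion of the trace in \<phi> is demanded, a condition that passes to
    unions of chains; equality follows because \<chi> contains the image of \<phi>.\<close>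
  define P where "P = {\<psi> \<in> Con S B. \<chi> \<subseteq> \<psi> \<and> pullback A f \<psi> \<subseteq> \<phi>}"
  have "\<chi> \<in> P"
    using \<chi> pullback_Cg_subset[OF A B f \<omega> \<phi>_Con sub] by (simp add: P_def \<chi>_def)
  moreover have "\<Union>K \<in> P" if "K \<noteq> {}" and "subset.chain P K" for K
  proof -
    have K: "K \<subseteq> P" and chain: "\<And>\<alpha> \<beta>. \<alpha> \<in> K \<Longrightarrow> \<beta> \<in> K \<Longrightarrow> \<alpha> \<subseteq> \<beta> \<or> \<beta> \<subseteq> \<alpha>"
      using that(2) by (auto simp: subset_chain_def)
    have "\<exists>\<gamma>\<in>K. \<alpha> \<union> \<beta> \<subseteq> \<gamma>" if "\<alpha> \<in> K" "\<beta> \<in> K" for \<alpha> \<beta>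
      using chain[OF that] that by (metis Un_least order_refl)
    then have "\<Union>K \<in> Con S B" using K \<open>K \<noteq> {}\<close> by (intro Con_directed_Union) (auto simp: P_def)
    moreover have "\<chi> \<subseteq> \<Union>K" using K \<open>K \<noteq> {}\<close> by (auto simp: P_def)
    moreover have "pullback A f (\<Union>K) \<subseteq> \<phi>" using K by (auto simp: P_def pullback_def)
    ultimately show ?thesis by (simp add: P_def)
  qed
  ultimately obtain \<psi> where "\<psi> \<in> P" and max: "\<And>\<psi>'. \<psi>' \<in> P \<Longrightarrow> \<psi> \<subseteq> \<psi>' \<Longrightarrow> \<psi>' = \<psi>"
    using subset_Zorn_nonempty[of P] by blast
  then have \<psi>: "\<psi> \<in> Con S B" "\<chi> \<subseteq> \<psi>" "pullback A f \<psi> \<subseteq> \<phi>" by (auto simp: P_def)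
  have "\<phi> \<subseteq> pullback A f \<psi>"
    using \<psi>(2) \<chi>_sup(1) Con_subset[OF \<phi>_Con] by (fastforce simp: pullback_def)
  then have eq: "pullback A f \<psi> = \<phi>" using \<psi>(3) by blast
  \<comment> \<open>By maximality a strictly larger congruence falls outside \<open>P\<close>; as it
    still contains \<chi>, it must fail through its trace.\<close>
  have not_in_P: "\<not> pullback A f (Cg S B (\<psi> \<union> \<alpha>)) \<subseteq> \<phi>"
    if \<alpha>: "\<alpha> \<in> Con S B" "\<not> \<alpha> \<subseteq> \<psi>" for \<alpha>
  proof -
    have "Cg S B (\<psi> \<union> \<alpha>) \<in> Con S B"
      using Con_subset[OF \<psi>(1)] Con_subset[OF \<alpha>(1)] by (intro Cg_in_Con[OF B.algebra]) auto
    moreover have "\<psi> \<union> \<alpha> \<subseteq> Cg S B (\<psi> \<union> \<alpha>)" by (rule Cg_superset)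
    ultimately show ?thesis
      using max[of "Cg S B (\<psi> \<union> \<alpha>)"] \<alpha>(2) \<psi>(2) by (auto simp: P_def)
  qed
  have "\<alpha> \<subseteq> \<psi> \<or> \<beta> \<subseteq> \<psi>" if \<alpha>: "\<alpha> \<in> Con S B" and \<beta>: "\<beta> \<in> Con S B" and sub: "\<alpha> \<inter> \<beta> \<subseteq> \<psi>" for \<alpha> \<beta>
  proof (rule ccontr)
    assume "\<not> (\<alpha> \<subseteq> \<psi> \<or> \<beta> \<subseteq> \<psi>)"
    then have neg: "\<not> pullback A f (Cg S B (\<psi> \<union> \<alpha>)) \<subseteq> \<phi>" "\<not> pullback A f (Cg S B (\<psi> \<union> \<beta>)) \<subseteq> \<phi>"
      using not_in_P \<alpha> \<beta> by blast+
    have "Cg S B (\<psi> \<union> \<alpha>) \<inter> Cg S B (\<psi> \<union> \<beta>) \<subseteq> Cg S B (\<psi> \<union> (\<alpha> \<inter> \<beta>))"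
      by (rule B.Cg_Int_distrib[OF \<alpha> \<beta> Con_subset[OF \<psi>(1)]])
    also have "\<dots> = \<psi>" using sub Cg_id[OF \<psi>(1)] by (simp add: Un_absorb2)
    finally have "pullback A f (Cg S B (\<psi> \<union> \<alpha>)) \<inter> pullback A f (Cg S B (\<psi> \<union> \<beta>)) \<subseteq> \<phi>"
      unfolding eq[symmetric] by (auto simp: pullback_def)
    moreover have "pullback A f (Cg S B (\<psi> \<union> \<gamma>)) \<in> Con S A" if "\<gamma> \<in> Con S B" for \<gamma>
      using Con_subset[OF \<psi>(1)] Con_subset[OF that]
      by (intro pullback_in_Con[OF A.algebra f] Cg_in_Con[OF B.algebra]) auto
    ultimately show False using \<phi>_prime \<alpha> \<beta> neg by blast
  qed
  \<comment> \<open>The full relation has full trace, whereas \<phi> is proper.\<close>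
  moreover have "\<psi> \<noteq> Nabla B"
    using eq \<phi>_proper hom_carrier[OF f] by (auto simp: pullback_def Nabla_def)
  ultimately have "\<psi> \<in> Spec S B" using \<psi>(1) by (simp add: Spec_def)
  then show ?thesis using eq \<psi>(2) \<chi>_sup(2) by blast
qed


section \<open>Free algebras\<close>

definition term_algebra :: "'f signature \<Rightarrow> ('f, ('f, 'v) trm) algebra" where
  "term_algebra S = \<lparr>carrier = {t. wf_trm S t}, interp = Fn\<rparr>"

definition free_cong ::
  "'f signature \<Rightarrow> (('f, nat) trm \<times> ('f, nat) trm) set \<Rightarrow> ('f, 'v) trm rel" where
  "free_cong S E = Cg S (term_algebra S)
    {(eval (term_algebra S) \<sigma> s, eval (term_algebra S) \<sigma> t) | s t \<sigma>.
      (s, t) \<in> E \<and> range \<sigma> \<subseteq> carrier (term_algebra S)}"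

text \<open>Its elements are representative terms instead of classes, so that with generators
  indexed by \<open>'a + 'b + nat\<close> it lives on the type \<open>univ\<close>.\<close>

definition free_algebra ::
  "'f signature \<Rightarrow> (('f, nat) trm \<times> ('f, nat) trm) set \<Rightarrow> ('f, ('f, 'v) trm) algebra" where
  "free_algebra S E = image_algebra (rep (free_cong S E)) (term_algebra S)"

text \<open>The class of the variable \<open>v\<close>; its representative need not be
  \<open>Var v\<close> itself.\<close>

definition gen ::
  "'f signature \<Rightarrow> (('f, nat) trm \<times> ('f, nat) trm) set \<Rightarrow> 'v \<Rightarrow> ('f, 'v) trm" where
  "gen S E v = rep (free_cong S E) (Var v)"

text \<open>Variables make the carrier non-empty even when the signature has no symbols.\<close>

lemma is_algebra_term_algebra: "is_algebra S (term_algebra S)"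
  by (auto simp: is_algebra_def closed_under_ops_def term_algebra_def intro: exI[of _ "Var _"])

lemma eval_hom_term_algebra:
  assumes "is_algebra S M" "range \<rho> \<subseteq> carrier M"
  shows "eval M \<rho> \<in> hom S (term_algebra S) M"
proof -
  have "eval M \<rho> t \<in> carrier M" if "wf_trm S t" for t
    using eval_in_carrier[OF assms(1) that] assms(2) by blast
  then show ?thesis by (auto simp: hom_def term_algebra_def)
qed

lemma free_cong_in_Con:
  fixes S :: "'f signature"
  assumes "identities S E"
  shows "(free_cong S E :: ('f, 'v) trm rel) \<in> Con S (term_algebra S)"
proof -
  have "eval (term_algebra S) \<sigma> r \<in> carrier (term_algebra S)"
    if "wf_trm S r" "range \<sigma> \<subseteq> carrier (term_algebra S)" for r and \<sigma> :: "nat \<Rightarrow> ('f, 'v) trm"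
    using eval_in_carrier[OF is_algebra_term_algebra that(1)] that(2) by blast
  then show ?thesis
    unfolding free_cong_def using assms
    by (intro Cg_in_Con is_algebra_term_algebra) (auto simp: identities_def)
qed

lemma
  fixes S :: "'f signature"
  assumes E: "identities S E"
  shows hom_rep_free_cong:
      "rep (free_cong S E :: ('f, 'v) trm rel) \<in> hom S (term_algebra S) (free_algebra S E)"
    and free_algebra_in_models:
      "(free_algebra S E :: ('f, ('f, 'v) trm) algebra) \<in> models S E"
proof -
  have fc: "(free_cong S E :: ('f, 'v) trm rel) \<in> Con S (term_algebra S)"
    by (rule free_cong_in_Con[OF E])
  show hom: "rep (free_cong S E :: ('f, 'v) trm rel) \<in> hom S (term_algebra S) (free_algebra S E)"
    unfolding free_algebra_def using ker_rel_rep[OF fc inj_on_id] fc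
    by (intro hom_image_algebra) simp
  show "(free_algebra S E :: ('f, ('f, 'v) trm) algebra) \<in> models S E"
  proof (rule models_onto[OF is_algebra_term_algebra hom _ E])
    fix s t and \<sigma> :: "nat \<Rightarrow> ('f, 'v) trm"
    assume st: "(s, t) \<in> E" and \<sigma>: "range \<sigma> \<subseteq> carrier (term_algebra S)"
    then have "(eval (term_algebra S) \<sigma> s, eval (term_algebra S) \<sigma> t) \<in> free_cong S E"
      unfolding free_cong_def by (intro Cg_superset[THEN subsetD]) blast
    then show "rep (free_cong S E) (eval (term_algebra S) \<sigma> s)
        = rep (free_cong S E) (eval (term_algebra S) \<sigma> t)"
      using rep_eq_iff[OF fc] Con_carrier[OF fc] by blast
  qed (simp add: free_algebra_def carrier_image_algebra)
qed

lemma free_algebra_carrier: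
  assumes "identities S E"
  shows "carrier (free_algebra S E) = rep (free_cong S E) ` {t. wf_trm S t}"
    and "t \<in> carrier (free_algebra S E) \<Longrightarrow> wf_trm S t"
    and "gen S E v \<in> carrier (free_algebra S E)"
proof -
  show eq: "carrier (free_algebra S E) = rep (free_cong S E) ` {t. wf_trm S t}"
    by (simp add: free_algebra_def carrier_image_algebra term_algebra_def)
  show "wf_trm S t" if t: "t \<in> carrier (free_algebra S E)"
  proof -
    obtain t' where "t = rep (free_cong S E) t'" "t' \<in> carrier (term_algebra S)"
      using t eq by (auto simp: term_algebra_def)
    then have "t \<in> carrier (term_algebra S)"
      using rep_in[OF free_cong_in_Con[OF assms]] Con_carrier(2)[OF free_cong_in_Con[OF assms]]
      by metis
    then show ?thesis by (simp add: term_algebra_def)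
  qed
  show "gen S E v \<in> carrier (free_algebra S E)" by (auto simp: eq gen_def)
qed

text \<open>Composing a substitution with an evaluation in \<open>M\<close> gives another assignment
  into \<open>M\<close>, so the kernel of evaluation contains every instance of an identity. Hence
  evaluation cannot see the choice of representatives.\<close>

lemma eval_rep_free_cong:
  fixes S :: "'f signature" and t :: "('f, 'v) trm"
  assumes E: "identities S E" and M: "M \<in> models S E" and \<rho>: "range \<rho> \<subseteq> carrier M"
    and t: "wf_trm S t"
  shows "eval M \<rho> (rep (free_cong S E) t) = eval M \<rho> t"
proof -
  let ?T = "term_algebra S :: ('f, ('f, 'v) trm) algebra"
  note T = is_algebra_term_algebra and alg = modelsD(1)[OF M]
  note hom = eval_hom_term_algebra[OF alg \<rho>]
  have "free_cong S E \<subseteq> pullback ?T (eval M \<rho>) (Delta M)"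
    unfolding free_cong_def
  proof (rule Cg_least[OF pullback_in_Con[OF T hom Delta_in_Con[OF alg]]], clarify)
    fix s t and \<sigma> :: "nat \<Rightarrow> ('f, 'v) trm"
    assume st: "(s, t) \<in> E" and \<sigma>: "range \<sigma> \<subseteq> carrier ?T"
    have wf: "wf_trm S s" "wf_trm S t" using E st by (auto simp: identities_def)
    have \<sigma>V: "\<sigma> ` V \<subseteq> carrier ?T" for V using \<sigma> by auto
    have "range (eval M \<rho> \<circ> \<sigma>) \<subseteq> carrier M" using \<sigma> hom_carrier[OF hom] by auto
    then have "eval M (eval M \<rho> \<circ> \<sigma>) s = eval M (eval M \<rho> \<circ> \<sigma>) t"
      by (rule modelsD(2)[OF M st])
    then have "eval M \<rho> (eval ?T \<sigma> s) = eval M \<rho> (eval ?T \<sigma> t)"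
      using hom_eval[OF T hom wf(1) \<sigma>V] hom_eval[OF T hom wf(2) \<sigma>V] by simp
    moreover have "eval ?T \<sigma> s \<in> carrier ?T" "eval ?T \<sigma> t \<in> carrier ?T"
      using eval_in_carrier[OF T] wf \<sigma>V by blast+
    ultimately show "(eval ?T \<sigma> s, eval ?T \<sigma> t) \<in> pullback ?T (eval M \<rho>) (Delta M)"
      using hom_carrier[OF hom] by (simp add: pullback_def Delta_def Id_on_iff)
  qed
  moreover have "(t, rep (free_cong S E) t) \<in> free_cong S E"
    using t by (intro rep_in[OF free_cong_in_Con[OF E]]) (simp add: term_algebra_def)
  ultimately show ?thesis by (auto simp: pullback_def Delta_def)
qed

lemma eval_gen:
  "identities S E \<Longrightarrow> M \<in> models S E \<Longrightarrow> range \<rho> \<subseteq> carrier M \<Longrightarrow> eval M \<rho> (gen S E v) = \<rho> v"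
  unfolding gen_def by (subst eval_rep_free_cong) auto

text \<open>The existence half of the universal property. Elements of the free algebra are
  well-formed terms, so plain evaluation can serve as the extension of \<rho>.\<close>

lemma eval_hom_free_algebra:
  fixes S :: "'f signature" and \<rho> :: "'v \<Rightarrow> 'a"
  assumes E: "identities S E" and M: "M \<in> models S E" and \<rho>: "range \<rho> \<subseteq> carrier M"
  shows "eval M \<rho> \<in> hom S (free_algebra S E) M"
  unfolding hom_def
proof (intro CollectI conjI ballI allI impI)
  have "\<rho> ` V \<subseteq> carrier M" for V using \<rho> by auto
  then show "eval M \<rho> ` carrier (free_algebra S E) \<subseteq> carrier M"
    using eval_in_carrier[OF modelsD(1)[OF M]] free_algebra_carrier(2)[OF E] by blast
  fix g and xs :: "('f, 'v) trm list"
  assume g: "g \<in> symbols S" and xs: "length xs = arity S g \<and> set xs \<subseteq> carrier (free_algebra S E)"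
  obtain ts where ts: "set ts \<subseteq> {t. wf_trm S t}" "xs = map (rep (free_cong S E)) ts"
    using ex_preimage_list xs free_algebra_carrier(1)[OF E] by metis
  have "interp (free_algebra S E) g xs = rep (free_cong S E) (interp (term_algebra S) g ts)"
    using hom_interp[OF hom_rep_free_cong[OF E] g, of ts] ts xs by (simp add: term_algebra_def)
  also have "interp (term_algebra S) g ts = Fn g ts" by (simp add: term_algebra_def)
  finally have "eval M \<rho> (interp (free_algebra S E) g xs) = eval M \<rho> (Fn g ts)"
    using eval_rep_free_cong[OF E M \<rho>, of "Fn g ts"] g ts xs by auto
  also have "\<dots> = interp M g (map (eval M \<rho>) xs)"
    using eval_rep_free_cong[OF E M \<rho>] ts by (auto simp: subset_iff intro!: arg_cong[where f = "interp M g"])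
  finally show "eval M \<rho> (interp (free_algebra S E) g xs) = interp M g (map (eval M \<rho>) xs)" .
qed


section \<open>Pulling back prime congruences\<close>

text \<open>Generators of \<open>Cg(x, y) \<inter> Cg(z, w)\<close> in a free algebra may involve further variables. These
  can be sent anywhere, in particular to \<open>f a\<close>, which makes the image of \<open>R\<close> lie in the range
  of \<open>f\<close>. The two fresh variables \<open>v4\<close>, \<open>v5\<close> are sent to the pair \<open>(u, v)\<close> under consideration.\<close>

lemma principal_Int_subset:
  fixes S :: "'f signature" and E :: "(('f, nat) trm \<times> ('f, nat) trm) set"
    and A :: "('f, 'a) algebra" and B :: "('f, 'b) algebra"
    and v0 v1 v2 v3 :: 'v
  defines "F \<equiv> free_algebra S E :: ('f, ('f, 'v) trm) algebra"
  assumes E: "identities S E" and A: "A \<in> models S E" and B: "B \<in> models S E"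
    and f: "f \<in> hom S A B"
    and FD: "edpc_algebra S n p q F" and BD: "edpc_algebra S n p q B"
    and inf: "infinite (UNIV :: 'v set)" and dist: "distinct [v0, v1, v2, v3]"
    and R: "finite R" "R \<subseteq> carrier F \<times> carrier F"
    and Int: "Cg S F {(gen S E v0, gen S E v1)} \<inter> Cg S F {(gen S E v2, gen S E v3)} = Cg S F R"
    and abcd: "{a, b, c, d} \<subseteq> carrier A" and \<psi>: "\<psi> \<in> Con S B"
    and sub: "Cg S A {(a, b)} \<inter> Cg S A {(c, d)} \<subseteq> pullback A f \<psi>"
  shows "Cg S B {(f a, f b)} \<inter> Cg S B {(f c, f d)} \<subseteq> \<psi>"
proof (rule subrelI)
  interpret F: edpc_algebra S n p q F by (rule FD)
  interpret B: edpc_algebra S n p q B by (rule BD)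
  note algA = modelsD(1)[OF A]
  fix u v assume uv: "(u, v) \<in> Cg S B {(f a, f b)} \<inter> Cg S B {(f c, f d)}"
  have fabcd: "{f a, f b, f c, f d} \<subseteq> carrier B" using abcd hom_carrier[OF f] by auto
  have "Cg S B {(f a, f b)} \<subseteq> carrier B \<times> carrier B"
    using fabcd by (intro Con_subset[OF Cg_in_Con[OF B.algebra]]) auto
  then have uv_carrier: "u \<in> carrier B" "v \<in> carrier B" using uv by auto
  define V where "V = {v0, v1, v2, v3} \<union> (\<Union>(s, t)\<in>R. vars s \<union> vars t)"
  have "finite V" using R(1) by (auto simp: V_def finite_vars)
  obtain v4 where v4: "v4 \<notin> V" using ex_new_if_finite[OF inf \<open>finite V\<close>] by blast
  obtain v5 where v5: "v5 \<notin> insert v4 V"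
    using ex_new_if_finite[OF inf, of "insert v4 V"] \<open>finite V\<close> by blast
  \<comment> \<open>\<open>v0\<close> receives \<open>a\<close> as the default value, along with
    every other variable not listed.\<close>
  define \<rho>A where "\<rho>A = (\<lambda>_. a)(v1 := b, v2 := c, v3 := d)"
  define \<rho> where "\<rho> = (f \<circ> \<rho>A)(v4 := u, v5 := v)"
  have \<rho>A: "range \<rho>A \<subseteq> carrier A" using abcd by (auto simp: \<rho>A_def)
  then have \<rho>: "range \<rho> \<subseteq> carrier B" using uv_carrier hom_carrier[OF f] by (auto simp: \<rho>_def)
  have \<rho>A_values: "\<rho>A v0 = a" "\<rho>A v1 = b" "\<rho>A v2 = c" "\<rho>A v3 = d"
    using dist by (auto simp: \<rho>A_def)
  have \<rho>_values: "\<rho> v0 = f a" "\<rho> v1 = f b" "\<rho> v2 = f c" "\<rho> v3 = f d" "\<rho> v4 = u" "\<rho> v5 = v"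
    using v4 v5 \<rho>A_values by (auto simp: \<rho>_def V_def)
  have hA: "eval A \<rho>A \<in> hom S F A" unfolding F_def by (rule eval_hom_free_algebra[OF E A \<rho>A])
  have h: "eval B \<rho> \<in> hom S F B" unfolding F_def by (rule eval_hom_free_algebra[OF E B \<rho>])
  note genA = eval_gen[OF E A \<rho>A] and genB = eval_gen[OF E B \<rho>]
  have gF: "gen S E w \<in> carrier F" for w unfolding F_def by (rule free_algebra_carrier(3)[OF E])
  \<comment> \<open>Evaluation need not reach all of \<open>B\<close>. It reaches the six elements
    in play, and the defining equations involve no others.\<close>
  define \<theta> where "\<theta> = pullback F (eval B \<rho>) (Delta B)"
  have \<theta>: "\<theta> \<in> Con S F"
    unfolding \<theta>_def by (rule pullback_in_Con[OF F.algebra h Delta_in_Con[OF B.algebra]])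
  \<comment> \<open>The equations for (u, v) hold in \<open>B\<close> modulo equality; both sides
    are values of terms in generators, so the same equations hold in \<open>F\<close> modulo the
    kernel \<theta>, and relative EDPC in \<open>F\<close> reads them back as a membership.\<close>
  have lift: "(gen S E v4, gen S E v5) \<in> Cg S F (\<theta> \<union> Cg S F {(gen S E w, gen S E w')})"
    if "(u, v) \<in> Cg S B {(\<rho> w, \<rho> w')}" for w w'
  proof -
    have c: "{\<rho> w, \<rho> w', u, v} \<subseteq> carrier B" using \<rho> uv_carrier by auto
    have cF: "{gen S E w, gen S E w', gen S E v4, gen S E v5} \<subseteq> carrier F" using gF by auto
    have "(u, v) \<in> Cg S B (insert (\<rho> w, \<rho> w') (Delta B))"
      using that Cg_mono[of "{(\<rho> w, \<rho> w')}" "insert (\<rho> w, \<rho> w') (Delta B)" S B] by auto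
    then have "\<forall>i\<in>{1..n}. (eval4 B (p i) (\<rho> w) (\<rho> w') u v, eval4 B (q i) (\<rho> w) (\<rho> w') u v) \<in> Delta B"
      using B.Cg_insert_iff[OF Delta_in_Con[OF B.algebra] c] by blast
    then have "\<forall>i\<in>{1..n}. (eval4 F (p i) (gen S E w) (gen S E w') (gen S E v4) (gen S E v5),
        eval4 F (q i) (gen S E w) (gen S E w') (gen S E v4) (gen S E v5)) \<in> \<theta>"
      using hom_eval4[OF F.algebra h _ cF] F.quaternary F.eval4_carrier[OF _ cF]
      by (simp add: \<theta>_def pullback_def genB \<rho>_values)
    then have "(gen S E v4, gen S E v5) \<in> Cg S F (insert (gen S E w, gen S E w') \<theta>)"
      using F.Cg_insert_iff[OF \<theta> cF] by blast
    then show ?thesis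
      using Cg_absorb[OF F.algebra, of \<theta> "{(gen S E w, gen S E w')}"] Con_subset[OF \<theta>] gF by simp
  qed
  have principal: "Cg S F {(gen S E w, gen S E w')} \<in> Con S F" for w w'
    using gF by (intro Cg_in_Con[OF F.algebra]) auto
  \<comment> \<open>Distributivity in \<open>F\<close> pulls the two joins with \<theta> together
    over the intersection generated by \<open>R\<close>.\<close>
  have "(gen S E v4, gen S E v5) \<in> Cg S F (\<theta> \<union> Cg S F R)"
    using F.Cg_Int_distrib[OF principal principal Con_subset[OF \<theta>], of v0 v1 v2 v3]
      lift[of v0 v1] lift[of v2 v3] uv unfolding \<rho>_values Int by blast
  moreover have "\<theta> \<union> Cg S F R \<subseteq> pullback F (eval B \<rho>) \<psi>"
  proof (rule Un_least)
    show "\<theta> \<subseteq> pullback F (eval B \<rho>) \<psi>"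
      using Con_refl[OF \<psi>] by (auto simp: \<theta>_def pullback_def Delta_def)
    show "Cg S F R \<subseteq> pullback F (eval B \<rho>) \<psi>"
    proof (rule Cg_least[OF pullback_in_Con[OF F.algebra h \<psi>]], rule subrelI)
      fix s t assume st: "(s, t) \<in> R"
      then have st_F: "s \<in> carrier F" "t \<in> carrier F" using R(2) by auto
      have st_Int: "(s, t) \<in> Cg S F {(gen S E v0, gen S E v1)} \<inter> Cg S F {(gen S E v2, gen S E v3)}"
        using st Cg_superset[of R S F] unfolding Int by blast
      have push: "(eval A \<rho>A s, eval A \<rho>A t) \<in> Cg S A {(\<rho>A w, \<rho>A w')}"
        if "(s, t) \<in> Cg S F {(gen S E w, gen S E w')}" for w w'
        using that
      proof (rule hom_Cg[OF F.algebra algA hA, rotated -1])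
        fix x y assume "(x, y) \<in> {(gen S E w, gen S E w')}"
        then show "(eval A \<rho>A x, eval A \<rho>A y) \<in> Cg S A {(\<rho>A w, \<rho>A w')}"
          using Cg_superset[of "{(\<rho>A w, \<rho>A w')}" S A] by (simp add: genA)
      qed (use gF \<rho>A in auto)
      have "(eval A \<rho>A s, eval A \<rho>A t) \<in> pullback A f \<psi>"
        using sub push[of v0 v1] push[of v2 v3] st_Int unfolding \<rho>A_values by blast
      then have "(f (eval A \<rho>A s), f (eval A \<rho>A t)) \<in> \<psi>" by (simp add: pullback_def)
      \<comment> \<open>On \<open>V\<close> the assignment \<rho> is \<open>f\<close> composed with
        \<open>\<rho>A\<close>, because \<open>v4\<close> and \<open>v5\<close> lie outside
        \<open>V\<close>.\<close>
      moreover have "f (eval A \<rho>A r) = eval B \<rho> r" if "r \<in> carrier F" "vars r \<subseteq> V" for r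
      proof -
        have "f (eval A \<rho>A r) = eval B (f \<circ> \<rho>A) r"
          using that(1) free_algebra_carrier(2)[OF E] \<rho>A unfolding F_def
          by (intro hom_eval[OF algA f]) auto
        also have "\<dots> = eval B \<rho> r"
          using that(2) v4 v5 by (intro eval_cong) (auto simp: \<rho>_def)
        finally show ?thesis .
      qed
      moreover have "vars s \<subseteq> V" "vars t \<subseteq> V" using st by (auto simp: V_def)
      ultimately show "(s, t) \<in> pullback F (eval B \<rho>) \<psi>" using st_F by (simp add: pullback_def)
    qed
  qed
  ultimately have "(gen S E v4, gen S E v5) \<in> pullback F (eval B \<rho>) \<psi>"
    using Cg_least[OF pullback_in_Con[OF F.algebra h \<psi>]] by blast
  then show "(u, v) \<in> \<psi>" by (simp add: pullback_def genB \<rho>_values)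
qed

text \<open>If the pullback were full, \<open>f\<close> would send \<open>A\<close> into a single
  class of \<psi>, giving a one-element subalgebra of the quotient of \<open>B\<close>.
  Semi-degeneracy then makes the quotient trivial, so \<psi> would be full.\<close>

lemma pullback_proper:
  fixes B :: "('f, 'b) algebra" and j :: "'b \<Rightarrow> 'c" and C :: "('f, 'c) algebra set"
  assumes E: "identities S E" and A: "is_algebra S A" and B: "B \<in> models S E"
    and f: "f \<in> hom S A B" and j: "inj j" and C: "C = models S E" and sd: "semi_degenerate S C"
    and \<psi>: "\<psi> \<in> Con S B" "\<psi> \<noteq> Nabla B"
  shows "pullback A f \<psi> \<noteq> Nabla A"
proof
  assume eq: "pullback A f \<psi> = Nabla A"
  define \<pi> where "\<pi> = j \<circ> rep \<psi>"
  define N where "N = image_algebra \<pi> B"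
  have ker: "ker_rel \<pi> B = \<psi>" unfolding \<pi>_def by (rule ker_rel_rep[OF \<psi>(1) j])
  have \<pi>: "\<pi> \<in> hom S B N" unfolding N_def by (rule hom_image_algebra) (simp only: ker \<psi>(1))
  have onto: "carrier N = \<pi> ` carrier B" unfolding N_def by (rule carrier_image_algebra)
  have N: "N \<in> C" unfolding N_def \<pi>_def C by (rule quotient_in_models[OF E B \<psi>(1) j])
  have \<pi>_eq: "\<pi> x = \<pi> y \<longleftrightarrow> (x, y) \<in> \<psi>" if "x \<in> carrier B" "y \<in> carrier B" for x y
    using that unfolding ker[symmetric] by (simp add: ker_rel_def)
  obtain a where a: "a \<in> carrier A" using A by (auto simp: is_algebra_def)
  have collapse: "\<pi> (f x) = \<pi> (f a)" if "x \<in> carrier A" for x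
  proof -
    have "(x, a) \<in> pullback A f \<psi>" using that a by (simp add: eq Nabla_def)
    then show ?thesis using \<pi>_eq hom_carrier[OF f] by (simp add: pullback_def)
  qed
  have "subuniverse S N {\<pi> (f a)}"
    unfolding subuniverse_def closed_under_ops_def
  proof (intro conjI ballI allI impI)
    show "{\<pi> (f a)} \<subseteq> carrier N" using onto a hom_carrier[OF f] by auto
    fix g xs assume g: "g \<in> symbols S" and xs: "length xs = arity S g \<and> set xs \<subseteq> {\<pi> (f a)}"
    have "set xs \<subseteq> \<pi> ` f ` {a}" using xs by auto
    then obtain ys where ys: "set ys \<subseteq> f ` {a}" "xs = map \<pi> ys" using ex_preimage_list by metis
    then obtain zs where zs: "set zs \<subseteq> {a}" "ys = map f zs" using ex_preimage_list by metis
    have zsA: "set zs \<subseteq> carrier A" "length zs = arity S g" using zs ys xs a by auto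
    have "set ys \<subseteq> carrier B" "length ys = arity S g"
      using ys xs a hom_carrier[OF f] by auto
    then have "interp N g xs = \<pi> (f (interp A g zs))"
      using hom_interp[OF f g zsA(2,1)] hom_interp[OF \<pi> g, of ys] zs(2) ys(2) by simp
    \<comment> \<open>The value comes from an element of \<open>A\<close>, and all of these collapse
      to the same point.\<close>
    then show "interp N g xs \<in> {\<pi> (f a)}" using collapse is_algebra_interp[OF A g zsA(2,1)] by simp
  qed simp
  then have "is_singleton (carrier N)"
    using sd N unfolding semi_degenerate_def by (metis is_singletonI)
  then have "\<pi> x = \<pi> y" if "x \<in> carrier B" "y \<in> carrier B" for x y
    using that onto unfolding is_singleton_def by (metis imageI singletonD)
  then have "Nabla B \<subseteq> \<psi>" using \<pi>_eq by (auto simp: Nabla_def)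
  then show False using Con_subset[OF \<psi>(1)] \<psi>(2) by (auto simp: Nabla_def)
qed

text \<open>The assumption \<open>Int\<close> is the common weakening of CIP and PIP that lets both
  parts share one proof.\<close>

lemma morphism_properties:
  fixes S :: "'f signature" and C :: "('f, ('f, 'a, 'b) univ) algebra set"
    and A :: "('f, 'a) algebra" and B :: "('f, 'b) algebra"
  assumes E: "identities S E" and C: "C = models S E"
    and A: "A \<in> models S E" and B: "B \<in> models S E" and f: "f \<in> hom S A B"
    and sd: "semi_degenerate S C" and edpc: "EDPC S C"
    and Int: "\<And>M \<alpha> \<beta>. M \<in> C \<Longrightarrow> \<alpha> \<in> principal_congs S M \<Longrightarrow> \<beta> \<in> principal_congs S M \<Longrightarrow>
      \<alpha> \<inter> \<beta> \<in> compact_congs S M"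
  shows "admissible S A B f \<and> going_up S A B f \<and> lying_over S A B f"
proof -
  obtain n and p q :: "nat \<Rightarrow> ('f, nat) trm" where
    pq_Cg: "(\<forall>i\<in>{1..n}. quaternary S (p i) \<and> quaternary S (q i)) \<and>
      (\<forall>M\<in>C. \<forall>a\<in>carrier M. \<forall>b\<in>carrier M.
        Cg S M {(a, b)} = {(c, d) \<in> carrier M \<times> carrier M.
          \<forall>i\<in>{1..n}. eval4 M (p i) a b c d = eval4 M (q i) a b c d})"
    using edpc unfolding EDPC_def by blast
  note pq = bspec[OF pq_Cg[THEN conjunct1]]
    and Cg = pq_Cg[THEN conjunct2, THEN bspec, THEN bspec, THEN bspec]
  define F :: "('f, ('f, 'a, 'b) univ) algebra" where "F = free_algebra S E"
  have F: "F \<in> models S E" unfolding F_def by (rule free_algebra_in_models[OF E])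
  \<comment> \<open>The copies of \<open>'a\<close> and \<open>'b\<close> inside the universe let
    EDPC be transferred to \<open>A\<close> and \<open>B\<close>.\<close>
  have injA: "inj (\<lambda>x. Var (Inl x) :: ('f, 'a, 'b) univ)"
    and injB: "inj (\<lambda>x. Var (Inr (Inl x)) :: ('f, 'a, 'b) univ)" by (auto simp: inj_def)
  note edpcI = edpc_algebra_models[OF E _ _ pq Cg[unfolded C]]
  have AD: "edpc_algebra S n p q A" by (rule edpcI[OF A injA])
  have BD: "edpc_algebra S n p q B" by (rule edpcI[OF B injB])
  have FD: "edpc_algebra S n p q F" by (rule edpcI[OF F inj_on_id])
  note algA = modelsD(1)[OF A] and algB = modelsD(1)[OF B]
  \<comment> \<open>The \<open>nat\<close> summand supplies four distinct generators, and infinitely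
    many more, even if \<open>'a\<close> and \<open>'b\<close> are finite.\<close>
  define w :: "nat \<Rightarrow> 'a + 'b + nat" where "w k = Inr (Inr k)" for k
  have gF: "gen S E v \<in> carrier F" for v unfolding F_def by (rule free_algebra_carrier(3)[OF E])
  have "Cg S F {(gen S E (w 0), gen S E (w 1))} \<inter> Cg S F {(gen S E (w 2), gen S E (w 3))}
      \<in> compact_congs S F"
    using gF F by (intro Int) (auto simp: C principal_congs_def)
  then obtain R where R: "finite R" "R \<subseteq> carrier F \<times> carrier F"
    "Cg S F {(gen S E (w 0), gen S E (w 1))} \<inter> Cg S F {(gen S E (w 2), gen S E (w 3))} = Cg S F R"
    by (auto simp: compact_congs_def)
  have inf: "infinite (UNIV :: ('a + 'b + nat) set)" by simp
  have dist: "distinct [w 0, w 1, w 2, w 3]" by (simp add: w_def)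
  have "pullback A f \<psi> \<in> Spec S A" if "\<psi> \<in> Spec S B" for \<psi>
  proof -
    have \<psi>: "\<psi> \<in> Con S B" "\<psi> \<noteq> Nabla B"
      and prime: "\<And>\<alpha> \<beta>. \<alpha> \<in> Con S B \<Longrightarrow> \<beta> \<in> Con S B \<Longrightarrow> \<alpha> \<inter> \<beta> \<subseteq> \<psi> \<Longrightarrow> \<alpha> \<subseteq> \<psi> \<or> \<beta> \<subseteq> \<psi>"
      using that by (auto simp: Spec_def)
    have "\<alpha> \<subseteq> pullback A f \<psi> \<or> \<beta> \<subseteq> pullback A f \<psi>"
      if \<alpha>: "\<alpha> \<in> Con S A" and \<beta>: "\<beta> \<in> Con S A" and sub: "\<alpha> \<inter> \<beta> \<subseteq> pullback A f \<psi>" for \<alpha> \<beta>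
    proof (rule ccontr)
      assume "\<not> (\<alpha> \<subseteq> pullback A f \<psi> \<or> \<beta> \<subseteq> pullback A f \<psi>)"
      \<comment> \<open>One witness pair from each congruence reduces primeness to principal
        congruences.\<close>
      then obtain a b c d where ab: "(a, b) \<in> \<alpha>" "(a, b) \<notin> pullback A f \<psi>"
        and cd: "(c, d) \<in> \<beta>" "(c, d) \<notin> pullback A f \<psi>" by (meson subrelI)
      have abcd: "{a, b, c, d} \<subseteq> carrier A"
        using Con_carrier[OF \<alpha> ab(1)] Con_carrier[OF \<beta> cd(1)] by auto
      have "Cg S A {(a, b)} \<subseteq> \<alpha>" using ab(1) by (intro Cg_least[OF \<alpha>]) simp
      moreover have "Cg S A {(c, d)} \<subseteq> \<beta>" using cd(1) by (intro Cg_least[OF \<beta>]) simp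
      ultimately have "Cg S A {(a, b)} \<inter> Cg S A {(c, d)} \<subseteq> pullback A f \<psi>" using sub by blast
      then have "Cg S B {(f a, f b)} \<inter> Cg S B {(f c, f d)} \<subseteq> \<psi>"
        using FD R unfolding F_def
        by (intro principal_Int_subset[OF E A B f _ BD inf dist _ _ _ abcd \<psi>(1)])
      moreover have "Cg S B {(f a, f b)} \<in> Con S B" "Cg S B {(f c, f d)} \<in> Con S B"
        using abcd hom_carrier[OF f] by (auto intro!: Cg_in_Con[OF algB])
      ultimately have "Cg S B {(f a, f b)} \<subseteq> \<psi> \<or> Cg S B {(f c, f d)} \<subseteq> \<psi>" using prime by blast
      then have "(f a, f b) \<in> \<psi> \<or> (f c, f d) \<in> \<psi>"
        using Cg_superset[of "{(f a, f b)}" S B] Cg_superset[of "{(f c, f d)}" S B] by blast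
      then show False using ab(2) cd(2) abcd by (auto simp: pullback_def)
    qed
    then show ?thesis
      using pullback_proper[OF E algA B f injB C sd \<psi>] pullback_in_Con[OF algA f \<psi>(1)]
      by (simp add: Spec_def)
  qed
  then have "admissible S A B f" by (simp add: admissible_def)
  moreover have "going_up S A B f"
    unfolding going_up_def
  proof (intro ballI impI)
    fix \<phi> \<psi> \<phi>\<^sub>1
    assume "\<psi> \<in> Spec S A" "\<phi>\<^sub>1 \<in> Spec S B" "\<phi> \<subseteq> \<psi> \<and> pullback A f \<phi>\<^sub>1 = \<phi>"
    then show "\<exists>\<psi>\<^sub>1\<in>Spec S B. \<phi>\<^sub>1 \<subseteq> \<psi>\<^sub>1 \<and> pullback A f \<psi>\<^sub>1 = \<psi>"
      by (intro prime_extension[OF AD BD f]) (auto simp: Spec_def)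
  qed
  moreover have "lying_over S A B f"
    unfolding lying_over_def Ker_def
    using prime_extension[OF AD BD f Delta_in_Con[OF algB]] by blast
  ultimately show ?thesis by blast
qed

theorem corollary8p15:
  fixes S :: "'f signature"
    and E :: "(('f, nat) trm \<times> ('f, nat) trm) set"
    and C :: "('f, ('f, 'a, 'b) univ) algebra set"
    and A :: "('f, 'a) algebra"
    and B :: "('f, 'b) algebra"
    and f :: "'a \<Rightarrow> 'b"
  assumes "identities S E"
    and "C = models S E"
    and "A \<in> models S E"
    and "B \<in> models S E"
    and "f \<in> hom S A B"
  shows "(semi_degenerate S C \<and> EDPC S C \<and> CIP S C \<longrightarrow>
            admissible S A B f \<and> going_up S A B f \<and> lying_over S A B f) \<and>
         (semi_degenerate S C \<and> EDPC S C \<and> PIP S C \<longrightarrow>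
            admissible S A B f \<and> going_up S A B f \<and> lying_over S A B f)"
proof -
  \<comment> \<open>Under CIP this makes the two given congruences compact; under PIP it makes their
    intersection compact.\<close>
  have principal: "principal_congs S M \<subseteq> compact_congs S M" for M :: "('f, ('f, 'a, 'b) univ) algebra"
  proof
    fix \<alpha> assume "\<alpha> \<in> principal_congs S M"
    then obtain a b where "\<alpha> = Cg S M {(a, b)}" "a \<in> carrier M" "b \<in> carrier M"
      by (auto simp: principal_congs_def)
    then show "\<alpha> \<in> compact_congs S M"
      unfolding compact_congs_def by (intro CollectI exI[of _ "{(a, b)}"]) simp
  qed
  show ?thesis
  proof (rule conjI; rule impI; elim conjE)
    assume "semi_degenerate S C" "EDPC S C" "CIP S C"
    then show "admissible S A B f \<and> going_up S A B f \<and> lying_over S A B f"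
      using principal unfolding CIP_def by (intro morphism_properties[OF assms]) blast+
  next
    assume "semi_degenerate S C" "EDPC S C" "PIP S C"
    then show "admissible S A B f \<and> going_up S A B f \<and> lying_over S A B f"
      using principal unfolding PIP_def by (intro morphism_properties[OF assms]) blast+
  qed
qed

end
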